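(* Let $\kappa$ be a field and $G$ a group. The semigroup $pm(G)$ of factor sets of partial projective representations of $G$ in $\kappa$-algebras coincides with the set of all $\kappa$-valued partial twists for $G$.
   Context: Algebras are associative and unital with $1\neq0$. A partial projective representation of $G$ in a unital $\kappa$-algebra $R$ is a map $\Gamma:G\to R$ for which there is $\sigma:G\times G\to\kappa$ such that for all $g,h\in G$: (1) $\sigma(g,h)=0$ implies $\Gamma(g^{-1})\Gamma(gh)=0$ and $\Gamma(gh)\Gamma(h^{-1})=0$; (2) $\Gamma(g^{-1})\Gamma(g)\Gamma(h)=\sigma(g,h)\Gamma(g^{-1})\Gamma(gh)$; (3) $\Gamma(g)\Gamma(h)\Gamma(h^{-1})=\sigma(g,h)\Gamma(gh)\Gamma(h^{-1})$; (4) $\Gamma(1_G)=1_R$. If moreover $\Gamma(g)\Gamma(h)=0$ implies $\sigma(g,h)=0$, then $\sigma$ is called a factor set of $\Gamma$. $pm(G)$ is the set of all factor sets of partial projective representations of $G$ in unital $\kappa$-algebras (a semigroup under pointwise multiplication). Unital partial action of $G$ on a $\kappa$-algebra $A$: a family of $\kappa$-algebra isomorphisms $\theta_g:D_{g^{-1}}\to D_g$ ($g\in G$), where $D_g$ is an ideal of $A$ generated by a central idempotent $1_g$ of $A$ ($D_g=0$ allowed), such that $D_1=A$, $\theta_1=\mathrm{id}_A$, $\theta_g(D_{g^{-1}}D_h)=D_gD_{gh}$, and $\theta_g\theta_h(a)=\theta_{gh}(a)$ for $a\in D_{h^{-1}}D_{(gh)^{-1}}$. A $\kappa$-valued twist of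 $\theta$ is a function $\sigma:G\times G\to\kappa$ with $\sigma(g,h)=0\iff 1_g1_{gh}=0$ such that $\varsigma_{g,h}:=\sigma(g,h)1_g1_{gh}$ satisfies $\varsigma_{1,g}=\varsigma_{g,1}=1_g$ and $\theta_g(1_{g^{-1}}\varsigma_{h,t})\varsigma_{g,ht}=\varsigma_{g,h}\varsigma_{gh,t}$ for all $g,h,t\in G$. A $\kappa$-valued partial twist for $G$ is a function $G\times G\to\kappa$ that is a $\kappa$-valued twist of some unital partial action of $G$ on some unital $\kappa$-algebra. *)

theory Defs
  imports "HOL-Algebra.Algebra"
begin

text \<open>
  The library locale \<open>algebra\<close> is restricted to commutative algebras, so associative unital
  nonzero algebras over a field are introduced here.
\<close>

locale unital_algebra = field K + module K A + A: ring A for K (structure) and A (structure) +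
  assumes smult_mult_left:
      "\<lbrakk>c \<in> carrier K; x \<in> carrier A; y \<in> carrier A\<rbrakk> \<Longrightarrow>
        (c \<odot>\<^bsub>A\<^esub> x) \<otimes>\<^bsub>A\<^esub> y = c \<odot>\<^bsub>A\<^esub> (x \<otimes>\<^bsub>A\<^esub> y)"
    and smult_mult_right:
      "\<lbrakk>c \<in> carrier K; x \<in> carrier A; y \<in> carrier A\<rbrakk> \<Longrightarrow>
        x \<otimes>\<^bsub>A\<^esub> (c \<odot>\<^bsub>A\<^esub> y) = c \<odot>\<^bsub>A\<^esub> (x \<otimes>\<^bsub>A\<^esub> y)"
    and one_neq_zero: "\<one>\<^bsub>A\<^esub> \<noteq> \<zero>\<^bsub>A\<^esub>"


section \<open>Partial projective representations\<close>

definition pproj_rep_with ::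
  "('g, 'm) monoid_scheme \<Rightarrow> ('k, 'n) ring_scheme \<Rightarrow> ('k, 'a) module \<Rightarrow>
    ('g \<Rightarrow> 'a) \<Rightarrow> ('g \<times> 'g \<Rightarrow> 'k) \<Rightarrow> bool" where
  "pproj_rep_with G K R \<Gamma> \<sigma> \<longleftrightarrow>
     \<Gamma> \<in> carrier G \<rightarrow> carrier R \<and>
     \<sigma> \<in> carrier G \<times> carrier G \<rightarrow>\<^sub>E carrier K \<and>
     (\<forall>g\<in>carrier G. \<forall>h\<in>carrier G.
        (\<sigma> (g, h) = \<zero>\<^bsub>K\<^esub> \<longrightarrow>
           \<Gamma> (inv\<^bsub>G\<^esub> g) \<otimes>\<^bsub>R\<^esub> \<Gamma> (g \<otimes>\<^bsub>G\<^esub> h) = \<zero>\<^bsub>R\<^esub> \<and>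
           \<Gamma> (g \<otimes>\<^bsub>G\<^esub> h) \<otimes>\<^bsub>R\<^esub> \<Gamma> (inv\<^bsub>G\<^esub> h) = \<zero>\<^bsub>R\<^esub>) \<and>
        \<Gamma> (inv\<^bsub>G\<^esub> g) \<otimes>\<^bsub>R\<^esub> \<Gamma> g \<otimes>\<^bsub>R\<^esub> \<Gamma> h =
          \<sigma> (g, h) \<odot>\<^bsub>R\<^esub> (\<Gamma> (inv\<^bsub>G\<^esub> g) \<otimes>\<^bsub>R\<^esub> \<Gamma> (g \<otimes>\<^bsub>G\<^esub> h)) \<and>
        \<Gamma> g \<otimes>\<^bsub>R\<^esub> \<Gamma> h \<otimes>\<^bsub>R\<^esub> \<Gamma> (inv\<^bsub>G\<^esub> h) =
          \<sigma> (g, h) \<odot>\<^bsub>R\<^esub> (\<Gamma> (g \<otimes>\<^bsub>G\<^esub> h) \<otimes>\<^bsub>R\<^esub> \<Gamma> (inv\<^bsub>G\<^esub> h))) \<and>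
     \<Gamma> \<one>\<^bsub>G\<^esub> = \<one>\<^bsub>R\<^esub>"

definition partial_projective_rep ::
  "('g, 'm) monoid_scheme \<Rightarrow> ('k, 'n) ring_scheme \<Rightarrow> ('k, 'a) module \<Rightarrow> ('g \<Rightarrow> 'a) \<Rightarrow> bool" where
  "partial_projective_rep G K R \<Gamma> \<longleftrightarrow> (\<exists>\<sigma>. pproj_rep_with G K R \<Gamma> \<sigma>)"

definition factor_set ::
  "('g, 'm) monoid_scheme \<Rightarrow> ('k, 'n) ring_scheme \<Rightarrow> ('k, 'a) module \<Rightarrow>
    ('g \<Rightarrow> 'a) \<Rightarrow> ('g \<times> 'g \<Rightarrow> 'k) \<Rightarrow> bool" where
  "factor_set G K R \<Gamma> \<sigma> \<longleftrightarrow>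
     pproj_rep_with G K R \<Gamma> \<sigma> \<and>
     (\<forall>g\<in>carrier G. \<forall>h\<in>carrier G.
        \<Gamma> g \<otimes>\<^bsub>R\<^esub> \<Gamma> h = \<zero>\<^bsub>R\<^esub> \<longrightarrow> \<sigma> (g, h) = \<zero>\<^bsub>K\<^esub>)"

definition factor_sets_over ::
  "'a itself \<Rightarrow> ('g, 'm) monoid_scheme \<Rightarrow> ('k, 'n) ring_scheme \<Rightarrow> ('g \<times> 'g \<Rightarrow> 'k) set" where
  "factor_sets_over (_ :: 'a itself) G K =
     {\<sigma>. \<exists>(R :: ('k, 'a) module) \<Gamma>.
        unital_algebra K R \<and> partial_projective_rep G K R \<Gamma> \<and> factor_set G K R \<Gamma> \<sigma>}"


section \<open>Unital partial actions and their twists\<close>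

text \<open>
  \<open>e g\<close> is the central idempotent written $1_g$, and \<open>pdom A e g\<close> is the ideal $D_g$ it generates.
  The latter is an algebra in its own right, with unit \<open>e g\<close>; it may be zero.
\<close>

definition pdom :: "('k, 'a) module \<Rightarrow> ('g \<Rightarrow> 'a) \<Rightarrow> 'g \<Rightarrow> 'a set" where
  "pdom A e g = Idl\<^bsub>A\<^esub> {e g}"

definition pdom_algebra :: "('k, 'a) module \<Rightarrow> ('g \<Rightarrow> 'a) \<Rightarrow> 'g \<Rightarrow> ('k, 'a) module" where
  "pdom_algebra A e g = A\<lparr>carrier := pdom A e g, one := e g\<rparr>"

definition algebra_iso ::
  "('k, 'n) ring_scheme \<Rightarrow> ('k, 'a) module \<Rightarrow> ('k, 'b) module \<Rightarrow> ('a \<Rightarrow> 'b) set" where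
  "algebra_iso K A B =
     {f \<in> ring_iso A B. \<forall>c\<in>carrier K. \<forall>x\<in>carrier A. f (c \<odot>\<^bsub>A\<^esub> x) = c \<odot>\<^bsub>B\<^esub> f x}"

definition unital_partial_action ::
  "('g, 'm) monoid_scheme \<Rightarrow> ('k, 'n) ring_scheme \<Rightarrow> ('k, 'a) module \<Rightarrow>
    ('g \<Rightarrow> 'a) \<Rightarrow> ('g \<Rightarrow> 'a \<Rightarrow> 'a) \<Rightarrow> bool" where
  "unital_partial_action G K A e \<theta> \<longleftrightarrow>
     (\<forall>g\<in>carrier G. e g \<in> carrier A \<and> e g \<otimes>\<^bsub>A\<^esub> e g = e g \<and>
        (\<forall>a\<in>carrier A. e g \<otimes>\<^bsub>A\<^esub> a = a \<otimes>\<^bsub>A\<^esub> e g)) \<and>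
     (\<forall>g\<in>carrier G. \<theta> g \<in> algebra_iso K (pdom_algebra A e (inv\<^bsub>G\<^esub> g)) (pdom_algebra A e g)) \<and>
     pdom A e \<one>\<^bsub>G\<^esub> = carrier A \<and>
     (\<forall>a\<in>carrier A. \<theta> \<one>\<^bsub>G\<^esub> a = a) \<and>
     (\<forall>g\<in>carrier G. \<forall>h\<in>carrier G.
        \<theta> g ` ideal_prod A (pdom A e (inv\<^bsub>G\<^esub> g)) (pdom A e h) =
          ideal_prod A (pdom A e g) (pdom A e (g \<otimes>\<^bsub>G\<^esub> h))) \<and>
     (\<forall>g\<in>carrier G. \<forall>h\<in>carrier G.
        \<forall>a\<in>ideal_prod A (pdom A e (inv\<^bsub>G\<^esub> h)) (pdom A e (inv\<^bsub>G\<^esub> (g \<otimes>\<^bsub>G\<^esub> h))).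
          \<theta> g (\<theta> h a) = \<theta> (g \<otimes>\<^bsub>G\<^esub> h) a)"

definition twist_elt ::
  "('g, 'm) monoid_scheme \<Rightarrow> ('k, 'a) module \<Rightarrow> ('g \<Rightarrow> 'a) \<Rightarrow> ('g \<times> 'g \<Rightarrow> 'k) \<Rightarrow> 'g \<Rightarrow> 'g \<Rightarrow> 'a" where
  "twist_elt G A e \<sigma> g h = \<sigma> (g, h) \<odot>\<^bsub>A\<^esub> (e g \<otimes>\<^bsub>A\<^esub> e (g \<otimes>\<^bsub>G\<^esub> h))"

definition valued_twist ::
  "('g, 'm) monoid_scheme \<Rightarrow> ('k, 'n) ring_scheme \<Rightarrow> ('k, 'a) module \<Rightarrow>
    ('g \<Rightarrow> 'a) \<Rightarrow> ('g \<Rightarrow> 'a \<Rightarrow> 'a) \<Rightarrow> ('g \<times> 'g \<Rightarrow> 'k) \<Rightarrow> bool" where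
  "valued_twist G K A e \<theta> \<sigma> \<longleftrightarrow>
     \<sigma> \<in> carrier G \<times> carrier G \<rightarrow>\<^sub>E carrier K \<and>
     (\<forall>g\<in>carrier G. \<forall>h\<in>carrier G.
        \<sigma> (g, h) = \<zero>\<^bsub>K\<^esub> \<longleftrightarrow> e g \<otimes>\<^bsub>A\<^esub> e (g \<otimes>\<^bsub>G\<^esub> h) = \<zero>\<^bsub>A\<^esub>) \<and>
     (\<forall>g\<in>carrier G. twist_elt G A e \<sigma> \<one>\<^bsub>G\<^esub> g = e g \<and> twist_elt G A e \<sigma> g \<one>\<^bsub>G\<^esub> = e g) \<and>
     (\<forall>g\<in>carrier G. \<forall>h\<in>carrier G. \<forall>t\<in>carrier G.
        \<theta> g (e (inv\<^bsub>G\<^esub> g) \<otimes>\<^bsub>A\<^esub> twist_elt G A e \<sigma> h t) \<otimes>\<^bsub>A\<^esub> twist_elt G A e \<sigma> g (h \<otimes>\<^bsub>G\<^esub> t) =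
          twist_elt G A e \<sigma> g h \<otimes>\<^bsub>A\<^esub> twist_elt G A e \<sigma> (g \<otimes>\<^bsub>G\<^esub> h) t)"

definition partial_twists_over ::
  "'a itself \<Rightarrow> ('g, 'm) monoid_scheme \<Rightarrow> ('k, 'n) ring_scheme \<Rightarrow> ('g \<times> 'g \<Rightarrow> 'k) set" where
  "partial_twists_over (_ :: 'a itself) G K =
     {\<sigma>. \<exists>(A :: ('k, 'a) module) e \<theta>.
        unital_algebra K A \<and> unital_partial_action G K A e \<theta> \<and> valued_twist G K A e \<theta> \<sigma>}"


section \<open>Algebras on arbitrary carriers\<close>

text \<open>
  Both sets of interest range over algebras on arbitrary carriers, and HOL cannot quantify over
  types inside a formula. The sets are therefore taken over one carrier type that is large
  enough: a $K$-algebra generated by a family indexed by $G$ is the image of the formal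
  expressions below, hence isomorphic to an algebra whose elements are such expressions. The
  subalgebra generated by the image of a partial projective representation, and the
  $\theta$-stable subalgebra generated by the idempotents $1_g$ of a partial action, are of
  this form and retain their factor set, respectively twist, so no function is lost by the
  restriction of the carrier type.
\<close>

datatype ('g, 'k) alg_expr =
    Gen 'g
  | Scal 'k
  | Add "('g, 'k) alg_expr" "('g, 'k) alg_expr"
  | Mul "('g, 'k) alg_expr" "('g, 'k) alg_expr"

definition pm :: "('g, 'm) monoid_scheme \<Rightarrow> ('k, 'n) ring_scheme \<Rightarrow> ('g \<times> 'g \<Rightarrow> 'k) set" where
  "pm G K = factor_sets_over TYPE(('g, 'k) alg_expr) G K"

definition partial_twists ::
  "('g, 'm) monoid_scheme \<Rightarrow> ('k, 'n) ring_scheme \<Rightarrow> ('g \<times> 'g \<Rightarrow> 'k) set" where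
  "partial_twists G K = partial_twists_over TYPE(('g, 'k) alg_expr) G K"

end

theory Submission
  imports Defs
begin

text \<open>
Both sets consist of the functions \<open>\<sigma>\<close> that are \<^emph>\<open>locally trivial\<close>, a condition that mentions no
algebra: \<open>\<sigma> (\<one>, \<one>) = 1\<close>, and whenever \<open>\<sigma> (g, h) \<noteq> 0\<close> the pairs \<open>(\<one>, g)\<close> and \<open>(g, g h)\<close> lie in the
support of a trivialization. A trivialization is a function \<open>f\<close> on \<open>G \<times> G\<close> whose support is
symmetric and transitive and contains \<open>(\<one>, \<one>)\<close>, such that
\<open>f (x, y) f (y, z) = \<sigma> (x\<inverse> y, y\<inverse> z) f (x, z)\<close> whenever \<open>(x, y)\<close> and \<open>(y, z)\<close> lie in the support.

From algebras to trivializations. If \<open>\<sigma> (g, h) \<noteq> 0\<close>, then on \<open>S = {\<one>, g, g h}\<close> the function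
\<open>f (x, y) = \<sigma> (x, x\<inverse> y)\<close>, extended by zero, is a trivialization, provided it has no zeros on \<open>S\<close> and \<open>\<sigma>\<close> satisfies the
cocycle identity for \<open>\<one>, x, y, z\<close> with \<open>x, y, z \<in> S\<close>. For a twist this holds because the cocycle
identity is valid wherever \<open>1\<^sub>x 1\<^sub>y 1\<^sub>z \<noteq> 0\<close>, and the nonzero idempotent \<open>1\<^sub>g 1\<^bsub>gh\<^esub>\<close> lies below
\<open>1\<^sub>x 1\<^sub>y 1\<^sub>z\<close> (\<open>locally_trivial_if_valued_twist\<close>). For a factor set only degenerate instances of the
identity occur, as two of \<open>\<one>, x, y, z\<close> coincide, and these follow from the defining relations
(\<open>locally_trivial_if_factor_set\<close>).

From trivializations to algebras. The group acts partially on the set of trivializations by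
translating both arguments, \<open>g\<close> being applicable to \<open>p\<close> if \<open>p (\<one>, g) \<noteq> 0\<close>. On \<open>K\<close>-valued functions \<open>v\<close>
of a trivialization, the operators \<open>(\<Gamma> g v) p = p (\<one>, g) v (shift g p)\<close> satisfy
\<open>\<Gamma> g \<Gamma> h = \<sigma> (g, h) 1\<^sub>g \<Gamma> (g h)\<close>, where \<open>1\<^sub>g\<close> is the indicator function of \<open>p (\<one>, g) \<noteq> 0\<close>; they form a
partial projective representation with factor set \<open>\<sigma>\<close> (\<open>factor_set_of_weighted_shifts\<close>). Translation
also acts partially on the commutative algebra generated by the functions \<open>1\<^sub>g\<close>, and \<open>\<sigma>\<close> is a twist of
this action (\<open>valued_twist_of_cutoffs\<close>).

Both algebras are generated by a family of linear operators indexed by \<open>G\<close>. Choosing one formal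
expression for each operator in the algebra realizes them with elements in the type of expressions
(\<open>op_algebra_unital_algebra\<close>). Hence the functions arising from algebras on an arbitrary carrier type
are locally trivial, and locally trivial functions already arise from algebras of expressions.
\<close>

section \<open>Local triviality\<close>

text \<open>
The support of \<open>f\<close> is an equivalence relation on a subset of \<open>G\<close> that contains \<open>\<one>\<close>. On the class of \<open>\<one>\<close>
the function \<open>f\<close> exhibits \<open>(x, y, z) \<mapsto> \<sigma> (x\<inverse> y, y\<inverse> z)\<close> as a coboundary. Carrying the
support inside \<open>f\<close>, instead of a separate subset of \<open>G\<close>, makes left translation by group elements a
single operation on such functions.
\<close>

definition trivialization ::
  "('g, 'm) monoid_scheme \<Rightarrow> ('k, 'n) ring_scheme \<Rightarrow> ('g \<times> 'g \<Rightarrow> 'k) \<Rightarrow> ('g \<times> 'g \<Rightarrow> 'k) \<Rightarrow> bool" where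
  "trivialization G K \<sigma> f \<longleftrightarrow>
     f \<in> carrier G \<times> carrier G \<rightarrow>\<^sub>E carrier K \<and> f (\<one>\<^bsub>G\<^esub>, \<one>\<^bsub>G\<^esub>) \<noteq> \<zero>\<^bsub>K\<^esub> \<and>
     (\<forall>x\<in>carrier G. \<forall>y\<in>carrier G. f (x, y) \<noteq> \<zero>\<^bsub>K\<^esub> \<longrightarrow> f (y, x) \<noteq> \<zero>\<^bsub>K\<^esub>) \<and>
     (\<forall>x\<in>carrier G. \<forall>y\<in>carrier G. \<forall>z\<in>carrier G.
        f (x, y) \<noteq> \<zero>\<^bsub>K\<^esub> \<longrightarrow> f (y, z) \<noteq> \<zero>\<^bsub>K\<^esub> \<longrightarrow> f (x, z) \<noteq> \<zero>\<^bsub>K\<^esub> \<and>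
          f (x, y) \<otimes>\<^bsub>K\<^esub> f (y, z) =
            \<sigma> (inv\<^bsub>G\<^esub> x \<otimes>\<^bsub>G\<^esub> y, inv\<^bsub>G\<^esub> y \<otimes>\<^bsub>G\<^esub> z) \<otimes>\<^bsub>K\<^esub> f (x, z))"

text \<open>
The normalization at the pair of units forces every trivialization to be 1 on the diagonal of its
support, and hence \<open>\<sigma> (\<one>, g)\<close> and \<open>\<sigma> (g, \<one>)\<close> to be 0 or 1 for all \<open>g\<close>.
\<close>

definition locally_trivial ::
  "('g, 'm) monoid_scheme \<Rightarrow> ('k, 'n) ring_scheme \<Rightarrow> ('g \<times> 'g \<Rightarrow> 'k) \<Rightarrow> bool" where
  "locally_trivial G K \<sigma> \<longleftrightarrow>
     \<sigma> \<in> carrier G \<times> carrier G \<rightarrow>\<^sub>E carrier K \<and> \<sigma> (\<one>\<^bsub>G\<^esub>, \<one>\<^bsub>G\<^esub>) = \<one>\<^bsub>K\<^esub> \<and>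
     (\<forall>g\<in>carrier G. \<forall>h\<in>carrier G. \<sigma> (g, h) \<noteq> \<zero>\<^bsub>K\<^esub> \<longrightarrow>
        (\<exists>f. trivialization G K \<sigma> f \<and> f (\<one>\<^bsub>G\<^esub>, g) \<noteq> \<zero>\<^bsub>K\<^esub> \<and> f (g, g \<otimes>\<^bsub>G\<^esub> h) \<noteq> \<zero>\<^bsub>K\<^esub>))"

text \<open>
The usual argument that a cocycle on a set with a base point is a coboundary: with base point \<open>\<one>\<close> the
choice \<open>f (x, y) = \<sigma> (x, x\<inverse> y)\<close> works, because the coboundary equation for \<open>x, y, z\<close> is then the cocycle
identity for the four points \<open>\<one>, x, y, z\<close>.
\<close>

lemma trivialization_from_base_point:
  fixes G :: "('g, 'm) monoid_scheme" and K :: "('k, 'n) ring_scheme"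
  assumes "group G" "field K"
    and \<sigma>: "\<sigma> \<in> carrier G \<times> carrier G \<rightarrow>\<^sub>E carrier K"
    and S: "S \<subseteq> carrier G" "\<one>\<^bsub>G\<^esub> \<in> S"
    and nonzero: "\<And>x y. \<lbrakk>x \<in> S; y \<in> S\<rbrakk> \<Longrightarrow> \<sigma> (x, inv\<^bsub>G\<^esub> x \<otimes>\<^bsub>G\<^esub> y) \<noteq> \<zero>\<^bsub>K\<^esub>"
    and cocycle: "\<And>x y z. \<lbrakk>x \<in> S; y \<in> S; z \<in> S\<rbrakk> \<Longrightarrow>
      \<sigma> (x, inv\<^bsub>G\<^esub> x \<otimes>\<^bsub>G\<^esub> y) \<otimes>\<^bsub>K\<^esub> \<sigma> (y, inv\<^bsub>G\<^esub> y \<otimes>\<^bsub>G\<^esub> z) =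
      \<sigma> (inv\<^bsub>G\<^esub> x \<otimes>\<^bsub>G\<^esub> y, inv\<^bsub>G\<^esub> y \<otimes>\<^bsub>G\<^esub> z) \<otimes>\<^bsub>K\<^esub> \<sigma> (x, inv\<^bsub>G\<^esub> x \<otimes>\<^bsub>G\<^esub> z)"
  obtains f where "trivialization G K \<sigma> f"
    and "\<And>x y. \<lbrakk>x \<in> S; y \<in> S\<rbrakk> \<Longrightarrow> f (x, y) \<noteq> \<zero>\<^bsub>K\<^esub>"
proof
  interpret G: group G by fact
  interpret K: field K by fact
  define f where "f = (\<lambda>(x, y)\<in>carrier G \<times> carrier G. if x \<in> S \<and> y \<in> S
    then \<sigma> (x, inv\<^bsub>G\<^esub> x \<otimes>\<^bsub>G\<^esub> y) else \<zero>\<^bsub>K\<^esub>)"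
  have f: "f (x, y) = \<sigma> (x, inv\<^bsub>G\<^esub> x \<otimes>\<^bsub>G\<^esub> y)" if "x \<in> S" "y \<in> S" for x y
    using that S by (auto simp: f_def)
  have supp: "x \<in> S \<and> y \<in> S"
    if "x \<in> carrier G" "y \<in> carrier G" "f (x, y) \<noteq> \<zero>\<^bsub>K\<^esub>" for x y
    using that by (auto simp: f_def split: if_splits)
  show nz: "f (x, y) \<noteq> \<zero>\<^bsub>K\<^esub>" if "x \<in> S" "y \<in> S" for x y
    using that nonzero by (simp add: f)
  have f_fun: "f \<in> carrier G \<times> carrier G \<rightarrow>\<^sub>E carrier K"
    using \<sigma> by (auto simp: f_def PiE_def Pi_def)
  have mult: "f (x, y) \<otimes>\<^bsub>K\<^esub> f (y, z) =
      \<sigma> (inv\<^bsub>G\<^esub> x \<otimes>\<^bsub>G\<^esub> y, inv\<^bsub>G\<^esub> y \<otimes>\<^bsub>G\<^esub> z) \<otimes>\<^bsub>K\<^esub> f (x, z)"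
    if "x \<in> S" "y \<in> S" "z \<in> S" for x y z
    using that by (simp add: f cocycle)
  show "trivialization G K \<sigma> f"
    unfolding trivialization_def
  proof (intro conjI ballI impI)
    show "f (\<one>\<^bsub>G\<^esub>, \<one>\<^bsub>G\<^esub>) \<noteq> \<zero>\<^bsub>K\<^esub>" using nz[OF S(2) S(2)] .
  qed (use f_fun in assumption, (meson supp nz mult)+)
qed

section \<open>Factor sets are locally trivial\<close>

context unital_algebra
begin

lemma smult_eq_zero:
  assumes "c \<odot>\<^bsub>A\<^esub> x = \<zero>\<^bsub>A\<^esub>" "c \<in> carrier K" "x \<in> carrier A" "c \<noteq> \<zero>\<^bsub>K\<^esub>"
  shows "x = \<zero>\<^bsub>A\<^esub>"
proof -
  have c: "c \<in> Units K" using assms by (simp add: field_Units)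
  have "x = (inv\<^bsub>K\<^esub> c \<otimes>\<^bsub>K\<^esub> c) \<odot>\<^bsub>A\<^esub> x"
    using c assms by simp
  also have "\<dots> = inv\<^bsub>K\<^esub> c \<odot>\<^bsub>A\<^esub> (c \<odot>\<^bsub>A\<^esub> x)"
    using c assms by (intro smult_assoc1) simp_all
  finally show ?thesis using assms c by simp
qed

lemma smult_cancel:
  assumes "c \<odot>\<^bsub>A\<^esub> x = d \<odot>\<^bsub>A\<^esub> x" "c \<in> carrier K" "d \<in> carrier K" "x \<in> carrier A" "x \<noteq> \<zero>\<^bsub>A\<^esub>"
  shows "c = d"
proof -
  have "(c \<ominus>\<^bsub>K\<^esub> d) \<odot>\<^bsub>A\<^esub> x = \<zero>\<^bsub>A\<^esub>"
    using assms by (simp add: a_minus_def smult_l_distr smult_l_minus M.r_neg)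
  then have "c \<ominus>\<^bsub>K\<^esub> d = \<zero>\<^bsub>K\<^esub>"
    using smult_eq_zero assms by blast
  then show ?thesis using assms by simp
qed

end

text \<open>
Nonvanishing of \<open>\<sigma> (g, h)\<close> gives \<open>\<Gamma> g \<Gamma> h \<noteq> 0\<close>, so scalars in front of this product can be compared.
The last two relations come from evaluating \<open>\<Gamma> g \<Gamma> (g\<inverse>) \<Gamma> g \<Gamma> h\<close> and \<open>\<Gamma> g \<Gamma> h \<Gamma> (h\<inverse>) \<Gamma> h\<close> in
two ways.
\<close>

lemma factor_set_relations:
  fixes G :: "('g, 'm) monoid_scheme" and K :: "('k, 'n) ring_scheme"
  assumes "group G" "unital_algebra K R" and fs: "factor_set G K R \<Gamma> \<sigma>"
    and gh: "g \<in> carrier G" "h \<in> carrier G" and nonzero: "\<sigma> (g, h) \<noteq> \<zero>\<^bsub>K\<^esub>"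
  shows "\<sigma> (g, inv\<^bsub>G\<^esub> g) \<noteq> \<zero>\<^bsub>K\<^esub>" "\<sigma> (h, inv\<^bsub>G\<^esub> h) \<noteq> \<zero>\<^bsub>K\<^esub>"
    and "\<sigma> (\<one>\<^bsub>G\<^esub>, g) = \<one>\<^bsub>K\<^esub>" "\<sigma> (g, \<one>\<^bsub>G\<^esub>) = \<one>\<^bsub>K\<^esub>" "\<sigma> (\<one>\<^bsub>G\<^esub>, h) = \<one>\<^bsub>K\<^esub>" "\<sigma> (h, \<one>\<^bsub>G\<^esub>) = \<one>\<^bsub>K\<^esub>"
    and "\<sigma> (g, h) \<otimes>\<^bsub>K\<^esub> \<sigma> (inv\<^bsub>G\<^esub> g, g \<otimes>\<^bsub>G\<^esub> h) = \<sigma> (g, inv\<^bsub>G\<^esub> g)"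
    and "\<sigma> (g, h) \<otimes>\<^bsub>K\<^esub> \<sigma> (g \<otimes>\<^bsub>G\<^esub> h, inv\<^bsub>G\<^esub> h) = \<sigma> (h, inv\<^bsub>G\<^esub> h)"
proof -
  interpret G: group G by fact
  interpret R: unital_algebra K R by fact
  have rep: "pproj_rep_with G K R \<Gamma> \<sigma>"
    using fs by (simp add: factor_set_def)
  have \<Gamma> [simp]: "\<Gamma> g \<in> carrier R" if "g \<in> carrier G" for g
    using rep that by (auto simp: pproj_rep_with_def)
  have \<sigma> [simp]: "\<sigma> (g, h) \<in> carrier K" if "g \<in> carrier G" "h \<in> carrier G" for g h
    using rep that by (auto simp: pproj_rep_with_def PiE_def Pi_def)
  have zero_r: "\<Gamma> (g \<otimes>\<^bsub>G\<^esub> h) \<otimes>\<^bsub>R\<^esub> \<Gamma> (inv\<^bsub>G\<^esub> h) = \<zero>\<^bsub>R\<^esub>"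
    if "g \<in> carrier G" "h \<in> carrier G" "\<sigma> (g, h) = \<zero>\<^bsub>K\<^esub>" for g h
    using rep that by (simp add: pproj_rep_with_def)
  have rel_l: "\<Gamma> (inv\<^bsub>G\<^esub> g) \<otimes>\<^bsub>R\<^esub> \<Gamma> g \<otimes>\<^bsub>R\<^esub> \<Gamma> h =
      \<sigma> (g, h) \<odot>\<^bsub>R\<^esub> (\<Gamma> (inv\<^bsub>G\<^esub> g) \<otimes>\<^bsub>R\<^esub> \<Gamma> (g \<otimes>\<^bsub>G\<^esub> h))"
    and rel_r: "\<Gamma> g \<otimes>\<^bsub>R\<^esub> \<Gamma> h \<otimes>\<^bsub>R\<^esub> \<Gamma> (inv\<^bsub>G\<^esub> h) =
      \<sigma> (g, h) \<odot>\<^bsub>R\<^esub> (\<Gamma> (g \<otimes>\<^bsub>G\<^esub> h) \<otimes>\<^bsub>R\<^esub> \<Gamma> (inv\<^bsub>G\<^esub> h))"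
    if "g \<in> carrier G" "h \<in> carrier G" for g h
    using rep that unfolding pproj_rep_with_def by blast+
  have \<Gamma>_one: "\<Gamma> \<one>\<^bsub>G\<^esub> = \<one>\<^bsub>R\<^esub>"
    using rep by (simp add: pproj_rep_with_def)
  note [simp] = R.smult_mult_left R.smult_mult_right R.smult_assoc1[symmetric]
  have triple: "\<Gamma> g \<otimes>\<^bsub>R\<^esub> \<Gamma> (inv\<^bsub>G\<^esub> g) \<otimes>\<^bsub>R\<^esub> \<Gamma> g = \<sigma> (g, inv\<^bsub>G\<^esub> g) \<odot>\<^bsub>R\<^esub> \<Gamma> g" if "g \<in> carrier G" for g
    using rel_r[of g "inv\<^bsub>G\<^esub> g"] that by (simp add: \<Gamma>_one)
  have s_nz: "\<sigma> (g, inv\<^bsub>G\<^esub> g) \<noteq> \<zero>\<^bsub>K\<^esub>" if "g \<in> carrier G" "\<Gamma> g \<noteq> \<zero>\<^bsub>R\<^esub>" for g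
    using zero_r[of g "inv\<^bsub>G\<^esub> g"] that by (auto simp: \<Gamma>_one)
  have gh_nz: "\<Gamma> g \<otimes>\<^bsub>R\<^esub> \<Gamma> h \<noteq> \<zero>\<^bsub>R\<^esub>"
  proof
    assume "\<Gamma> g \<otimes>\<^bsub>R\<^esub> \<Gamma> h = \<zero>\<^bsub>R\<^esub>"
    then show False using fs gh nonzero by (simp add: factor_set_def)
  qed
  then have g_nz: "\<Gamma> g \<noteq> \<zero>\<^bsub>R\<^esub>" and h_nz: "\<Gamma> h \<noteq> \<zero>\<^bsub>R\<^esub>"
    using gh by auto
  show "\<sigma> (g, inv\<^bsub>G\<^esub> g) \<noteq> \<zero>\<^bsub>K\<^esub>" "\<sigma> (h, inv\<^bsub>G\<^esub> h) \<noteq> \<zero>\<^bsub>K\<^esub>"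
    using s_nz gh g_nz h_nz by simp_all
  have one_l: "\<sigma> (\<one>\<^bsub>G\<^esub>, g) = \<one>\<^bsub>K\<^esub>" and one_r: "\<sigma> (g, \<one>\<^bsub>G\<^esub>) = \<one>\<^bsub>K\<^esub>"
    if g: "g \<in> carrier G" and nz: "\<Gamma> g \<noteq> \<zero>\<^bsub>R\<^esub>" for g
  proof -
    have "\<Gamma> g \<otimes>\<^bsub>R\<^esub> \<Gamma> (inv\<^bsub>G\<^esub> g) \<otimes>\<^bsub>R\<^esub> \<Gamma> g \<noteq> \<zero>\<^bsub>R\<^esub>"
      using R.smult_eq_zero[of "\<sigma> (g, inv\<^bsub>G\<^esub> g)" "\<Gamma> g"] s_nz[OF g nz] g nz
      by (auto simp: triple)
    then have *: "\<Gamma> g \<otimes>\<^bsub>R\<^esub> \<Gamma> (inv\<^bsub>G\<^esub> g) \<noteq> \<zero>\<^bsub>R\<^esub>" "\<Gamma> (inv\<^bsub>G\<^esub> g) \<otimes>\<^bsub>R\<^esub> \<Gamma> g \<noteq> \<zero>\<^bsub>R\<^esub>"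
      using g R.A.m_assoc[of "\<Gamma> g" "\<Gamma> (inv\<^bsub>G\<^esub> g)" "\<Gamma> g"] by auto
    have "\<sigma> (\<one>\<^bsub>G\<^esub>, g) \<odot>\<^bsub>R\<^esub> (\<Gamma> g \<otimes>\<^bsub>R\<^esub> \<Gamma> (inv\<^bsub>G\<^esub> g)) = \<one>\<^bsub>K\<^esub> \<odot>\<^bsub>R\<^esub> (\<Gamma> g \<otimes>\<^bsub>R\<^esub> \<Gamma> (inv\<^bsub>G\<^esub> g))"
      using rel_r[of "\<one>\<^bsub>G\<^esub>" g] g by (simp add: \<Gamma>_one)
    then show "\<sigma> (\<one>\<^bsub>G\<^esub>, g) = \<one>\<^bsub>K\<^esub>"
      by (rule R.smult_cancel) (use g * in simp_all)
    have "\<sigma> (g, \<one>\<^bsub>G\<^esub>) \<odot>\<^bsub>R\<^esub> (\<Gamma> (inv\<^bsub>G\<^esub> g) \<otimes>\<^bsub>R\<^esub> \<Gamma> g) = \<one>\<^bsub>K\<^esub> \<odot>\<^bsub>R\<^esub> (\<Gamma> (inv\<^bsub>G\<^esub> g) \<otimes>\<^bsub>R\<^esub> \<Gamma> g)"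
      using rel_l[of g "\<one>\<^bsub>G\<^esub>"] g by (simp add: \<Gamma>_one)
    then show "\<sigma> (g, \<one>\<^bsub>G\<^esub>) = \<one>\<^bsub>K\<^esub>"
      by (rule R.smult_cancel) (use g * in simp_all)
  qed
  show "\<sigma> (\<one>\<^bsub>G\<^esub>, g) = \<one>\<^bsub>K\<^esub>" "\<sigma> (g, \<one>\<^bsub>G\<^esub>) = \<one>\<^bsub>K\<^esub>" "\<sigma> (\<one>\<^bsub>G\<^esub>, h) = \<one>\<^bsub>K\<^esub>" "\<sigma> (h, \<one>\<^bsub>G\<^esub>) = \<one>\<^bsub>K\<^esub>"
    using one_l one_r gh g_nz h_nz by simp_all
  have cancel: "c = d"
    if "c \<odot>\<^bsub>R\<^esub> (\<Gamma> g \<otimes>\<^bsub>R\<^esub> \<Gamma> h) = d \<odot>\<^bsub>R\<^esub> (\<Gamma> g \<otimes>\<^bsub>R\<^esub> \<Gamma> h)" "c \<in> carrier K" "d \<in> carrier K" for c d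
    using R.smult_cancel[OF that] gh gh_nz by simp
  show "\<sigma> (g, h) \<otimes>\<^bsub>K\<^esub> \<sigma> (inv\<^bsub>G\<^esub> g, g \<otimes>\<^bsub>G\<^esub> h) = \<sigma> (g, inv\<^bsub>G\<^esub> g)"
  proof (rule cancel)
    have "\<Gamma> g \<otimes>\<^bsub>R\<^esub> (\<Gamma> (inv\<^bsub>G\<^esub> g) \<otimes>\<^bsub>R\<^esub> \<Gamma> g \<otimes>\<^bsub>R\<^esub> \<Gamma> h) = \<sigma> (g, inv\<^bsub>G\<^esub> g) \<odot>\<^bsub>R\<^esub> (\<Gamma> g \<otimes>\<^bsub>R\<^esub> \<Gamma> h)"
      using gh triple[of g] by (simp add: R.A.m_assoc[symmetric])
    moreover have "\<Gamma> g \<otimes>\<^bsub>R\<^esub> (\<Gamma> (inv\<^bsub>G\<^esub> g) \<otimes>\<^bsub>R\<^esub> \<Gamma> g \<otimes>\<^bsub>R\<^esub> \<Gamma> h) =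
        \<sigma> (g, h) \<odot>\<^bsub>R\<^esub> (\<Gamma> g \<otimes>\<^bsub>R\<^esub> \<Gamma> (inv\<^bsub>G\<^esub> g) \<otimes>\<^bsub>R\<^esub> \<Gamma> (g \<otimes>\<^bsub>G\<^esub> h))"
      using gh rel_l[of g h] by (simp add: R.A.m_assoc)
    moreover have "\<Gamma> g \<otimes>\<^bsub>R\<^esub> \<Gamma> (inv\<^bsub>G\<^esub> g) \<otimes>\<^bsub>R\<^esub> \<Gamma> (g \<otimes>\<^bsub>G\<^esub> h) =
        \<sigma> (inv\<^bsub>G\<^esub> g, g \<otimes>\<^bsub>G\<^esub> h) \<odot>\<^bsub>R\<^esub> (\<Gamma> g \<otimes>\<^bsub>R\<^esub> \<Gamma> h)"
      using gh rel_l[of "inv\<^bsub>G\<^esub> g" "g \<otimes>\<^bsub>G\<^esub> h"] by (simp add: G.m_assoc[symmetric])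
    ultimately show "(\<sigma> (g, h) \<otimes>\<^bsub>K\<^esub> \<sigma> (inv\<^bsub>G\<^esub> g, g \<otimes>\<^bsub>G\<^esub> h)) \<odot>\<^bsub>R\<^esub> (\<Gamma> g \<otimes>\<^bsub>R\<^esub> \<Gamma> h) =
        \<sigma> (g, inv\<^bsub>G\<^esub> g) \<odot>\<^bsub>R\<^esub> (\<Gamma> g \<otimes>\<^bsub>R\<^esub> \<Gamma> h)"
      using gh by simp
  qed (use gh in simp_all)
  show "\<sigma> (g, h) \<otimes>\<^bsub>K\<^esub> \<sigma> (g \<otimes>\<^bsub>G\<^esub> h, inv\<^bsub>G\<^esub> h) = \<sigma> (h, inv\<^bsub>G\<^esub> h)"
  proof (rule cancel)
    have "\<Gamma> g \<otimes>\<^bsub>R\<^esub> \<Gamma> h \<otimes>\<^bsub>R\<^esub> \<Gamma> (inv\<^bsub>G\<^esub> h) \<otimes>\<^bsub>R\<^esub> \<Gamma> h = \<sigma> (h, inv\<^bsub>G\<^esub> h) \<odot>\<^bsub>R\<^esub> (\<Gamma> g \<otimes>\<^bsub>R\<^esub> \<Gamma> h)"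
      using gh triple[of h] by (simp add: R.A.m_assoc)
    moreover have "\<Gamma> g \<otimes>\<^bsub>R\<^esub> \<Gamma> h \<otimes>\<^bsub>R\<^esub> \<Gamma> (inv\<^bsub>G\<^esub> h) \<otimes>\<^bsub>R\<^esub> \<Gamma> h =
        \<sigma> (g, h) \<odot>\<^bsub>R\<^esub> (\<Gamma> (g \<otimes>\<^bsub>G\<^esub> h) \<otimes>\<^bsub>R\<^esub> \<Gamma> (inv\<^bsub>G\<^esub> h) \<otimes>\<^bsub>R\<^esub> \<Gamma> h)"
      using gh by (simp add: rel_r)
    moreover have "\<Gamma> (g \<otimes>\<^bsub>G\<^esub> h) \<otimes>\<^bsub>R\<^esub> \<Gamma> (inv\<^bsub>G\<^esub> h) \<otimes>\<^bsub>R\<^esub> \<Gamma> h =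
        \<sigma> (g \<otimes>\<^bsub>G\<^esub> h, inv\<^bsub>G\<^esub> h) \<odot>\<^bsub>R\<^esub> (\<Gamma> g \<otimes>\<^bsub>R\<^esub> \<Gamma> h)"
      using gh rel_r[of "g \<otimes>\<^bsub>G\<^esub> h" "inv\<^bsub>G\<^esub> h"] by (simp add: G.m_assoc)
    ultimately show "(\<sigma> (g, h) \<otimes>\<^bsub>K\<^esub> \<sigma> (g \<otimes>\<^bsub>G\<^esub> h, inv\<^bsub>G\<^esub> h)) \<odot>\<^bsub>R\<^esub> (\<Gamma> g \<otimes>\<^bsub>R\<^esub> \<Gamma> h) =
        \<sigma> (h, inv\<^bsub>G\<^esub> h) \<odot>\<^bsub>R\<^esub> (\<Gamma> g \<otimes>\<^bsub>R\<^esub> \<Gamma> h)"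
      using gh by simp
  qed (use gh in simp_all)
qed

text \<open>
The cocycle identity is needed for the four points \<open>\<one>, x, y, z\<close> when \<open>x, y, z\<close> range over the
set \<open>{\<one>, g, g h}\<close>. Two of the four points must coincide, and each of the six possible
coincidences turns the identity into a consequence of the relations above.
\<close>

lemma locally_trivial_if_factor_set:
  fixes G :: "('g, 'm) monoid_scheme" and K :: "('k, 'n) ring_scheme"
  assumes "group G" "unital_algebra K R" and fs: "factor_set G K R \<Gamma> \<sigma>"
  shows "locally_trivial G K \<sigma>"
proof -
  interpret G: group G by fact
  interpret R: unital_algebra K R by fact
  note rels = factor_set_relations[OF assms]
  have \<sigma>_fun: "\<sigma> \<in> carrier G \<times> carrier G \<rightarrow>\<^sub>E carrier K"
    using fs by (simp add: factor_set_def pproj_rep_with_def)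
  then have \<sigma> [simp]: "\<sigma> (g, h) \<in> carrier K" if "g \<in> carrier G" "h \<in> carrier G" for g h
    using that by (auto simp: PiE_def Pi_def)
  have "\<Gamma> \<one>\<^bsub>G\<^esub> = \<one>\<^bsub>R\<^esub>"
    "\<Gamma> (inv\<^bsub>G\<^esub> \<one>\<^bsub>G\<^esub>) \<otimes>\<^bsub>R\<^esub> \<Gamma> \<one>\<^bsub>G\<^esub> \<otimes>\<^bsub>R\<^esub> \<Gamma> \<one>\<^bsub>G\<^esub> =
      \<sigma> (\<one>\<^bsub>G\<^esub>, \<one>\<^bsub>G\<^esub>) \<odot>\<^bsub>R\<^esub> (\<Gamma> (inv\<^bsub>G\<^esub> \<one>\<^bsub>G\<^esub>) \<otimes>\<^bsub>R\<^esub> \<Gamma> (\<one>\<^bsub>G\<^esub> \<otimes>\<^bsub>G\<^esub> \<one>\<^bsub>G\<^esub>))"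
    using fs unfolding factor_set_def pproj_rep_with_def by blast+
  then have "\<sigma> (\<one>\<^bsub>G\<^esub>, \<one>\<^bsub>G\<^esub>) \<odot>\<^bsub>R\<^esub> \<one>\<^bsub>R\<^esub> = \<one>\<^bsub>K\<^esub> \<odot>\<^bsub>R\<^esub> \<one>\<^bsub>R\<^esub>"
    by simp
  then have one_one: "\<sigma> (\<one>\<^bsub>G\<^esub>, \<one>\<^bsub>G\<^esub>) = \<one>\<^bsub>K\<^esub>"
    by (rule R.smult_cancel) (simp_all add: R.one_neq_zero)
  have "\<exists>f. trivialization G K \<sigma> f \<and> f (\<one>\<^bsub>G\<^esub>, g) \<noteq> \<zero>\<^bsub>K\<^esub> \<and> f (g, g \<otimes>\<^bsub>G\<^esub> h) \<noteq> \<zero>\<^bsub>K\<^esub>"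
    if gh: "g \<in> carrier G" "h \<in> carrier G" and nz: "\<sigma> (g, h) \<noteq> \<zero>\<^bsub>K\<^esub>" for g h
  proof -
    define k where "k = g \<otimes>\<^bsub>G\<^esub> h"
    have k [simp]: "k \<in> carrier G" using gh by (simp add: k_def)
    have cancel [simp]: "x \<otimes>\<^bsub>G\<^esub> (inv\<^bsub>G\<^esub> x \<otimes>\<^bsub>G\<^esub> y) = y" "inv\<^bsub>G\<^esub> x \<otimes>\<^bsub>G\<^esub> (x \<otimes>\<^bsub>G\<^esub> y) = y"
      if "x \<in> carrier G" "y \<in> carrier G" for x y
      using that by (simp_all add: G.m_assoc[symmetric])
    note [simp] = G.inv_mult_group G.m_assoc
    have sym: "\<sigma> (y, inv\<^bsub>G\<^esub> y \<otimes>\<^bsub>G\<^esub> x) \<noteq> \<zero>\<^bsub>K\<^esub>"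
      if "x \<in> carrier G" "y \<in> carrier G" "\<sigma> (x, inv\<^bsub>G\<^esub> x \<otimes>\<^bsub>G\<^esub> y) \<noteq> \<zero>\<^bsub>K\<^esub>" for x y
      using rels(2,8)[of x "inv\<^bsub>G\<^esub> x \<otimes>\<^bsub>G\<^esub> y"] that by auto
    have gk: "\<sigma> (g, inv\<^bsub>G\<^esub> g \<otimes>\<^bsub>G\<^esub> k) \<noteq> \<zero>\<^bsub>K\<^esub>"
      using nz gh by (simp add: k_def)
    note kg = sym[OF gh(1) k gk]
    let ?S = "{\<one>\<^bsub>G\<^esub>, g, k}"
    have S: "?S \<subseteq> carrier G" "\<one>\<^bsub>G\<^esub> \<in> ?S" using gh by auto
    have nonzero: "\<sigma> (x, inv\<^bsub>G\<^esub> x \<otimes>\<^bsub>G\<^esub> y) \<noteq> \<zero>\<^bsub>K\<^esub>" if "x \<in> ?S" "y \<in> ?S" for x y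
      using that gh gk kg one_one rels(1,3,4)[OF _ _ gk] rels(1,3,4)[OF _ _ kg] by auto
    have cocycle: "\<sigma> (x, inv\<^bsub>G\<^esub> x \<otimes>\<^bsub>G\<^esub> y) \<otimes>\<^bsub>K\<^esub> \<sigma> (y, inv\<^bsub>G\<^esub> y \<otimes>\<^bsub>G\<^esub> z) =
        \<sigma> (inv\<^bsub>G\<^esub> x \<otimes>\<^bsub>G\<^esub> y, inv\<^bsub>G\<^esub> y \<otimes>\<^bsub>G\<^esub> z) \<otimes>\<^bsub>K\<^esub> \<sigma> (x, inv\<^bsub>G\<^esub> x \<otimes>\<^bsub>G\<^esub> z)"
      if xyz: "x \<in> ?S" "y \<in> ?S" "z \<in> ?S" for x y z
    proof -
      have [simp]: "x \<in> carrier G" "y \<in> carrier G" "z \<in> carrier G" using xyz S by auto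
      note nz1 = nonzero[OF S(2)] and nzxy = nonzero[OF xyz(1,2)] and nzyz = nonzero[OF xyz(2,3)]
        and nzxz = nonzero[OF xyz(1,3)]
      have "x = \<one>\<^bsub>G\<^esub> \<or> x = y \<or> y = z \<or> y = \<one>\<^bsub>G\<^esub> \<or> z = x \<or> z = \<one>\<^bsub>G\<^esub>"
        using xyz by auto
      then consider "x = \<one>\<^bsub>G\<^esub>" | "x = y" | "y = z" | "y = \<one>\<^bsub>G\<^esub>" | "z = x" | "z = \<one>\<^bsub>G\<^esub>"
        by blast
      then show ?thesis
      proof cases
        case 1
        then show ?thesis
          using rels(3)[OF _ _ nzyz] rels(5)[of "\<one>\<^bsub>G\<^esub>" z] nz1[OF xyz(3)] by simp
      next
        case 2
        then show ?thesis
          using rels(4,5)[OF _ _ nzxz] by simp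
      next
        case 3
        then show ?thesis
          using rels(4)[OF _ _ nzyz] rels(6)[OF _ _ nzxy] by (simp add: R.m_comm)
      next
        case 4
        then show ?thesis
          using rels(7)[OF _ _ nzxz] rels(5)[of "\<one>\<^bsub>G\<^esub>" z] nz1[OF xyz(3)] by (simp add: R.m_comm)
      next
        case 5
        then show ?thesis
          using rels(8)[OF _ _ nzxy] rels(4)[OF _ _ nzxy] by simp
      next
        case 6
        \<comment> \<open>Both \<open>\<sigma> (x, a)\<close> and \<open>\<sigma> (a, y\<inverse>)\<close> are linked to \<open>\<sigma> (x\<inverse>, y)\<close>, which is eliminated.\<close>
        let ?a = "inv\<^bsub>G\<^esub> x \<otimes>\<^bsub>G\<^esub> y"
        have 7: "\<sigma> (x, ?a) \<otimes>\<^bsub>K\<^esub> \<sigma> (inv\<^bsub>G\<^esub> x, y) = \<sigma> (x, inv\<^bsub>G\<^esub> x)"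
          using rels(7)[OF _ _ nzxy] by simp
        then have "\<sigma> (inv\<^bsub>G\<^esub> x, y) \<noteq> \<zero>\<^bsub>K\<^esub>"
          using rels(1)[OF _ _ nzxy] by auto
        then have 8: "\<sigma> (inv\<^bsub>G\<^esub> x, y) \<otimes>\<^bsub>K\<^esub> \<sigma> (?a, inv\<^bsub>G\<^esub> y) = \<sigma> (y, inv\<^bsub>G\<^esub> y)"
          using rels(8)[of "inv\<^bsub>G\<^esub> x" y] by simp
        show ?thesis
          using 6 by (simp add: 7[symmetric] 8[symmetric] R.m_ac)
      qed
    qed
    obtain f where "trivialization G K \<sigma> f"
      and f: "\<And>x y. \<lbrakk>x \<in> ?S; y \<in> ?S\<rbrakk> \<Longrightarrow> f (x, y) \<noteq> \<zero>\<^bsub>K\<^esub>"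
      using trivialization_from_base_point[OF \<open>group G\<close> R.field_axioms \<sigma>_fun S nonzero cocycle]
      by blast
    then show ?thesis using f[of "\<one>\<^bsub>G\<^esub>" g] f[of g k] by (auto simp: k_def)
  qed
  then show ?thesis
    using \<sigma>_fun one_one by (simp add: locally_trivial_def)
qed

section \<open>Central idempotents and unital partial actions\<close>

context ring
begin

lemma genideal_central_idempotent:
  assumes c: "c \<in> carrier R" "c \<otimes> c = c" "\<And>a. a \<in> carrier R \<Longrightarrow> c \<otimes> a = a \<otimes> c"
  shows "Idl {c} = {a \<in> carrier R. c \<otimes> a = a}"
proof (rule equalityI)
  have "ideal {a \<in> carrier R. c \<otimes> a = a} R"
  proof (rule idealI[OF ring_axioms])
    show "subgroup {a \<in> carrier R. c \<otimes> a = a} (add_monoid R)"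
    proof (rule add.subgroupI)
      fix a assume "a \<in> {a \<in> carrier R. c \<otimes> a = a}"
      then show "\<ominus> a \<in> {a \<in> carrier R. c \<otimes> a = a}"
        using c(1) by (simp add: r_minus)
    qed (use c(1) in \<open>auto simp: r_distr intro!: exI[of _ \<zero>]\<close>)
  next
    fix a x assume "a \<in> {a \<in> carrier R. c \<otimes> a = a}" "x \<in> carrier R"
    then show "a \<otimes> x \<in> {a \<in> carrier R. c \<otimes> a = a}"
      using c(1) by (simp add: m_assoc[symmetric])
    have "c \<otimes> (x \<otimes> a) = x \<otimes> (c \<otimes> a)"
      using \<open>a \<in> _\<close> \<open>x \<in> carrier R\<close> c(1) c(3)[of x] by (metis (no_types, lifting) m_assoc mem_Collect_eq)
    then show "x \<otimes> a \<in> {a \<in> carrier R. c \<otimes> a = a}"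
      using \<open>a \<in> _\<close> \<open>x \<in> carrier R\<close> by simp
  qed
  then show "Idl {c} \<subseteq> {a \<in> carrier R. c \<otimes> a = a}"
    by (rule genideal_minimal) (use c(1,2) in simp)
  interpret I: ideal "Idl {c}" R
    by (rule genideal_ideal) (use c(1,2) in simp)
  show "{a \<in> carrier R. c \<otimes> a = a} \<subseteq> Idl {c}"
    using I.I_r_closed[OF genideal_self'[OF c(1)]] by force
qed

lemma ideal_prod_central_idempotents:
  assumes c: "c \<in> carrier R" "c \<otimes> c = c" "\<And>a. a \<in> carrier R \<Longrightarrow> c \<otimes> a = a \<otimes> c"
    and d: "d \<in> carrier R" "d \<otimes> d = d" "\<And>a. a \<in> carrier R \<Longrightarrow> d \<otimes> a = a \<otimes> d"
  shows "ideal_prod R (Idl {c}) (Idl {d}) = {a \<in> carrier R. c \<otimes> a = a \<and> d \<otimes> a = a}"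
proof (rule equalityI)
  have "ideal_prod R (Idl {c}) (Idl {d}) \<subseteq> Idl {c} \<inter> Idl {d}"
    by (rule ideal_prod_inter) (use c(1) d(1) in \<open>simp_all add: genideal_ideal\<close>)
  then show "ideal_prod R (Idl {c}) (Idl {d}) \<subseteq> {a \<in> carrier R. c \<otimes> a = a \<and> d \<otimes> a = a}"
    by (auto simp: genideal_central_idempotent[OF c] genideal_central_idempotent[OF d])
  show "{a \<in> carrier R. c \<otimes> a = a \<and> d \<otimes> a = a} \<subseteq> ideal_prod R (Idl {c}) (Idl {d})"
  proof
    fix a assume a: "a \<in> {a \<in> carrier R. c \<otimes> a = a \<and> d \<otimes> a = a}"
    then have "a \<in> Idl {d}"
      by (simp add: genideal_central_idempotent[OF d])
    then have "c \<otimes> a \<in> ideal_prod R (Idl {c}) (Idl {d})"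
      by (intro ideal_prod.prod genideal_self' c)
    then show "a \<in> ideal_prod R (Idl {c}) (Idl {d})" using a by simp
  qed
qed

end

lemma unital_partial_actionD:
  assumes "unital_partial_action G K A e \<theta>" and g: "g \<in> carrier G"
  shows "e g \<in> carrier A" "e g \<otimes>\<^bsub>A\<^esub> e g = e g"
    and "\<And>a. a \<in> carrier A \<Longrightarrow> e g \<otimes>\<^bsub>A\<^esub> a = a \<otimes>\<^bsub>A\<^esub> e g"
    and "\<theta> g \<in> algebra_iso K (pdom_algebra A e (inv\<^bsub>G\<^esub> g)) (pdom_algebra A e g)"
    and "pdom A e \<one>\<^bsub>G\<^esub> = carrier A"
    and "\<And>h. h \<in> carrier G \<Longrightarrow> \<theta> g ` ideal_prod A (pdom A e (inv\<^bsub>G\<^esub> g)) (pdom A e h) =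
      ideal_prod A (pdom A e g) (pdom A e (g \<otimes>\<^bsub>G\<^esub> h))"
proof -
  note act = assms(1)[unfolded unital_partial_action_def]
  note e = act[THEN conjunct1, rule_format, OF g]
  show "e g \<in> carrier A" "e g \<otimes>\<^bsub>A\<^esub> e g = e g"
    by (rule e[THEN conjunct1], rule e[THEN conjunct2, THEN conjunct1])
  show "e g \<otimes>\<^bsub>A\<^esub> a = a \<otimes>\<^bsub>A\<^esub> e g" if "a \<in> carrier A" for a
    using e[THEN conjunct2, THEN conjunct2] that by (rule bspec)
  note act = act[THEN conjunct2]
  show "\<theta> g \<in> algebra_iso K (pdom_algebra A e (inv\<^bsub>G\<^esub> g)) (pdom_algebra A e g)"
    using act[THEN conjunct1] g by (rule bspec)
  note act = act[THEN conjunct2]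
  show "pdom A e \<one>\<^bsub>G\<^esub> = carrier A"
    by (rule act[THEN conjunct1])
  note act = act[THEN conjunct2, THEN conjunct2]
  show "\<theta> g ` ideal_prod A (pdom A e (inv\<^bsub>G\<^esub> g)) (pdom A e h) =
      ideal_prod A (pdom A e g) (pdom A e (g \<otimes>\<^bsub>G\<^esub> h))" if "h \<in> carrier G" for h
    using act[THEN conjunct1] g that by blast
qed

text \<open>
The product \<open>1\<^bsub>g\<inverse>\<^esub> 1\<^sub>h\<close> is the unit of the ideal \<open>D\<^bsub>g\<inverse>\<^esub> D\<^sub>h\<close>, and \<open>\<theta>\<^sub>g\<close> maps this ideal
multiplicatively onto \<open>D\<^sub>g D\<^bsub>gh\<^esub>\<close>; a unit goes to a unit.
\<close>

lemma partial_action_unit: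
  fixes G :: "('g, 'm) monoid_scheme" and K :: "('k, 'n) ring_scheme"
  assumes "group G" "unital_algebra K A" and act: "unital_partial_action G K A e \<theta>"
    and gh: "g \<in> carrier G" "h \<in> carrier G"
  shows "\<theta> g (e (inv\<^bsub>G\<^esub> g) \<otimes>\<^bsub>A\<^esub> e h) = e g \<otimes>\<^bsub>A\<^esub> e (g \<otimes>\<^bsub>G\<^esub> h)"
proof -
  interpret G: group G by fact
  interpret A: unital_algebra K A by fact
  note e = unital_partial_actionD(1-3)[OF act]
  let ?P = "\<lambda>g h. {a \<in> carrier A. e g \<otimes>\<^bsub>A\<^esub> a = a \<and> e h \<otimes>\<^bsub>A\<^esub> a = a}"
  have unit: "e g \<otimes>\<^bsub>A\<^esub> e h \<in> ?P g h" if "g \<in> carrier G" "h \<in> carrier G" for g h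
  proof -
    have "e h \<otimes>\<^bsub>A\<^esub> (e g \<otimes>\<^bsub>A\<^esub> e h) = e g \<otimes>\<^bsub>A\<^esub> (e h \<otimes>\<^bsub>A\<^esub> e h)"
      using that e(1) e(3)[of h "e g"] by (simp add: A.A.m_assoc[symmetric])
    then show ?thesis
      using that e(1,2) by (simp add: A.A.m_assoc[symmetric])
  qed
  have P: "ideal_prod A (pdom A e g) (pdom A e h) = ?P g h"
    if "g \<in> carrier G" "h \<in> carrier G" for g h
    unfolding pdom_def
    by (rule A.A.ideal_prod_central_idempotents[OF e[OF that(1)] e[OF that(2)]])
  have "\<theta> g ` ideal_prod A (pdom A e (inv\<^bsub>G\<^esub> g)) (pdom A e h) =
      ideal_prod A (pdom A e g) (pdom A e (g \<otimes>\<^bsub>G\<^esub> h))"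
    using unital_partial_actionD(6)[OF act gh] .
  then have img: "\<theta> g ` ?P (inv\<^bsub>G\<^esub> g) h = ?P g (g \<otimes>\<^bsub>G\<^esub> h)"
    using gh by (simp add: P)
  have dom: "pdom A e (inv\<^bsub>G\<^esub> g) = {a \<in> carrier A. e (inv\<^bsub>G\<^esub> g) \<otimes>\<^bsub>A\<^esub> a = a}"
    unfolding pdom_def by (rule A.A.genideal_central_idempotent[OF e[OF G.inv_closed[OF gh(1)]]])
  have "\<theta> g \<in> algebra_iso K (pdom_algebra A e (inv\<^bsub>G\<^esub> g)) (pdom_algebra A e g)"
    using unital_partial_actionD(4)[OF act gh(1)] .
  then have mult: "\<theta> g (a \<otimes>\<^bsub>A\<^esub> b) = \<theta> g a \<otimes>\<^bsub>A\<^esub> \<theta> g b"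
    if "a \<in> ?P (inv\<^bsub>G\<^esub> g) h" "b \<in> ?P (inv\<^bsub>G\<^esub> g) h" for a b
    using that by (auto simp: algebra_iso_def ring_iso_def ring_hom_def pdom_algebra_def dom)
  let ?u = "e (inv\<^bsub>G\<^esub> g) \<otimes>\<^bsub>A\<^esub> e h" and ?w = "e g \<otimes>\<^bsub>A\<^esub> e (g \<otimes>\<^bsub>G\<^esub> h)"
  have u: "?u \<in> ?P (inv\<^bsub>G\<^esub> g) h" and w: "?w \<in> ?P g (g \<otimes>\<^bsub>G\<^esub> h)"
    using gh unit by simp_all
  \<comment> \<open>Each of \<open>w\<close> and \<open>\<theta> g u\<close> is absorbed by the other: \<open>w\<close> is the unit of the target ideal, and \<open>\<theta> g u\<close>
    fixes \<open>w = \<theta> g v\<close> because \<open>u\<close> fixes \<open>v\<close>.\<close>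
  obtain v where v: "v \<in> ?P (inv\<^bsub>G\<^esub> g) h" "?w = \<theta> g v"
    using w img by blast
  have \<theta>u: "\<theta> g ?u \<in> ?P g (g \<otimes>\<^bsub>G\<^esub> h)"
    using u img by blast
  have "?u \<otimes>\<^bsub>A\<^esub> v = v"
    using v(1) e(1) gh by (simp add: A.A.m_assoc)
  then have "\<theta> g ?u \<otimes>\<^bsub>A\<^esub> ?w = ?w"
    using mult[OF u v(1)] v(2) by simp
  moreover have "\<theta> g ?u \<otimes>\<^bsub>A\<^esub> ?w = ?w \<otimes>\<^bsub>A\<^esub> \<theta> g ?u"
  proof -
    have "?w \<otimes>\<^bsub>A\<^esub> a = a \<otimes>\<^bsub>A\<^esub> ?w" if a: "a \<in> carrier A" for a
    proof -
      have "?w \<otimes>\<^bsub>A\<^esub> a = e g \<otimes>\<^bsub>A\<^esub> (a \<otimes>\<^bsub>A\<^esub> e (g \<otimes>\<^bsub>G\<^esub> h))"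
        using a gh e(1) e(3)[of "g \<otimes>\<^bsub>G\<^esub> h" a] by (simp add: A.A.m_assoc)
      also have "\<dots> = a \<otimes>\<^bsub>A\<^esub> ?w"
        using a gh e(1) e(3)[of g a] by (simp add: A.A.m_assoc[symmetric])
      finally show ?thesis .
    qed
    then show ?thesis using \<theta>u by simp
  qed
  moreover have "?w \<otimes>\<^bsub>A\<^esub> \<theta> g ?u = \<theta> g ?u"
    using \<theta>u e(1) gh by (simp add: A.A.m_assoc)
  ultimately show ?thesis by simp
qed

text \<open>
Here \<open>\<theta> g\<close> is a multiplicative map on the whole algebra, to be thought of as \<open>a \<mapsto> \<theta>\<^sub>g (1\<^bsub>g\<inverse>\<^esub> a)\<close>. It
sends \<open>\<one>\<close> to \<open>1\<^sub>g\<close>, so it has image in \<open>D\<^sub>g\<close>, and on the ideals \<open>D\<^bsub>g\<inverse>\<^esub>\<close> and \<open>D\<^sub>g\<close> the maps for \<open>g\<close> and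
\<open>g\<inverse>\<close> are mutually inverse. All remaining requirements follow by applying \<open>\<theta> g\<close> to equations \<open>1\<^sub>h a = a\<close>.
\<close>

lemma unital_partial_actionI:
  fixes G :: "('g, 'm) monoid_scheme" and K :: "('k, 'n) ring_scheme"
  assumes "group G" "unital_algebra K A"
    and e_closed: "\<And>g. g \<in> carrier G \<Longrightarrow> e g \<in> carrier A"
    and e_idem: "\<And>g. g \<in> carrier G \<Longrightarrow> e g \<otimes>\<^bsub>A\<^esub> e g = e g"
    and e_central: "\<And>g a. g \<in> carrier G \<Longrightarrow> a \<in> carrier A \<Longrightarrow> e g \<otimes>\<^bsub>A\<^esub> a = a \<otimes>\<^bsub>A\<^esub> e g"
    and e_one: "e \<one>\<^bsub>G\<^esub> = \<one>\<^bsub>A\<^esub>"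
    and \<theta>_closed: "\<And>g a. g \<in> carrier G \<Longrightarrow> a \<in> carrier A \<Longrightarrow> \<theta> g a \<in> carrier A"
    and \<theta>_add: "\<And>g a b. \<lbrakk>g \<in> carrier G; a \<in> carrier A; b \<in> carrier A\<rbrakk> \<Longrightarrow>
      \<theta> g (a \<oplus>\<^bsub>A\<^esub> b) = \<theta> g a \<oplus>\<^bsub>A\<^esub> \<theta> g b"
    and \<theta>_mult: "\<And>g a b. \<lbrakk>g \<in> carrier G; a \<in> carrier A; b \<in> carrier A\<rbrakk> \<Longrightarrow>
      \<theta> g (a \<otimes>\<^bsub>A\<^esub> b) = \<theta> g a \<otimes>\<^bsub>A\<^esub> \<theta> g b"
    and \<theta>_smult: "\<And>g c a. \<lbrakk>g \<in> carrier G; c \<in> carrier K; a \<in> carrier A\<rbrakk> \<Longrightarrow>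
      \<theta> g (c \<odot>\<^bsub>A\<^esub> a) = c \<odot>\<^bsub>A\<^esub> \<theta> g a"
    and \<theta>_e: "\<And>g h. \<lbrakk>g \<in> carrier G; h \<in> carrier G\<rbrakk> \<Longrightarrow>
      \<theta> g (e h) = e g \<otimes>\<^bsub>A\<^esub> e (g \<otimes>\<^bsub>G\<^esub> h)"
    and \<theta>_one: "\<And>a. a \<in> carrier A \<Longrightarrow> \<theta> \<one>\<^bsub>G\<^esub> a = a"
    and \<theta>_\<theta>: "\<And>g h a. \<lbrakk>g \<in> carrier G; h \<in> carrier G; a \<in> carrier A\<rbrakk> \<Longrightarrow>
      \<theta> g (\<theta> h a) = e g \<otimes>\<^bsub>A\<^esub> \<theta> (g \<otimes>\<^bsub>G\<^esub> h) a"
  shows "unital_partial_action G K A e \<theta>"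
proof -
  interpret G: group G by fact
  interpret A: unital_algebra K A by fact
  note [simp] = e_closed \<theta>_closed e_idem
  let ?D = "\<lambda>g. {a \<in> carrier A. e g \<otimes>\<^bsub>A\<^esub> a = a}"
  let ?P = "\<lambda>g h. {a \<in> carrier A. e g \<otimes>\<^bsub>A\<^esub> a = a \<and> e h \<otimes>\<^bsub>A\<^esub> a = a}"
  have pdom: "pdom A e g = ?D g" if "g \<in> carrier G" for g
    unfolding pdom_def
    by (rule A.A.genideal_central_idempotent[OF e_closed[OF that] e_idem[OF that] e_central[OF that]])
  have prod: "ideal_prod A (pdom A e g) (pdom A e h) = ?P g h"
    if "g \<in> carrier G" "h \<in> carrier G" for g h
    unfolding pdom_def
    by (rule A.A.ideal_prod_central_idempotents[OF e_closed[OF that(1)] e_idem[OF that(1)]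
          e_central[OF that(1)] e_closed[OF that(2)] e_idem[OF that(2)] e_central[OF that(2)]])
  have absorb: "e g \<otimes>\<^bsub>A\<^esub> (e g \<otimes>\<^bsub>A\<^esub> a) = e g \<otimes>\<^bsub>A\<^esub> a" if "g \<in> carrier G" "a \<in> carrier A" for g a
    using that by (simp add: A.A.m_assoc[symmetric])
  have \<theta>_range: "e g \<otimes>\<^bsub>A\<^esub> \<theta> g a = \<theta> g a" if "g \<in> carrier G" "a \<in> carrier A" for g a
  proof -
    have "\<theta> g \<one>\<^bsub>A\<^esub> = e g"
      using \<theta>_e[of g "\<one>\<^bsub>G\<^esub>"] that by (simp add: e_one)
    then show ?thesis
      using \<theta>_mult[of g "\<one>\<^bsub>A\<^esub>" a] that by simp
  qed
  have \<theta>_unit: "\<theta> g (e (inv\<^bsub>G\<^esub> g)) = e g" if "g \<in> carrier G" for g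
    using \<theta>_e[of g "inv\<^bsub>G\<^esub> g"] that by (simp add: e_one)
  have \<theta>_inv: "\<theta> g (\<theta> (inv\<^bsub>G\<^esub> g) a) = a" if "g \<in> carrier G" "a \<in> ?D g" for g a
    using \<theta>_\<theta>[of g "inv\<^bsub>G\<^esub> g" a] that by (simp add: \<theta>_one)
  have \<theta>_inv': "\<theta> (inv\<^bsub>G\<^esub> g) (\<theta> g a) = a" if "g \<in> carrier G" "a \<in> ?D (inv\<^bsub>G\<^esub> g)" for g a
    using \<theta>_\<theta>[of "inv\<^bsub>G\<^esub> g" g a] that by (simp add: \<theta>_one)
  have \<theta>_prod: "\<theta> g a \<in> ?P g (g \<otimes>\<^bsub>G\<^esub> h)"
    if g: "g \<in> carrier G" and h: "h \<in> carrier G" and a: "a \<in> carrier A" "e h \<otimes>\<^bsub>A\<^esub> a = a" for g h a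
  proof -
    have "\<theta> g a = e g \<otimes>\<^bsub>A\<^esub> e (g \<otimes>\<^bsub>G\<^esub> h) \<otimes>\<^bsub>A\<^esub> \<theta> g a"
      using \<theta>_mult[of g "e h" a] g h a by (simp add: \<theta>_e)
    also have "\<dots> = e (g \<otimes>\<^bsub>G\<^esub> h) \<otimes>\<^bsub>A\<^esub> \<theta> g a"
      using g h a e_central[of g "e (g \<otimes>\<^bsub>G\<^esub> h)"] by (simp add: A.A.m_assoc \<theta>_range)
    finally show ?thesis
      using \<theta>_range g a by simp
  qed
  have iso: "\<theta> g \<in> algebra_iso K (pdom_algebra A e (inv\<^bsub>G\<^esub> g)) (pdom_algebra A e g)"
    if g: "g \<in> carrier G" for g
  proof -
    have "bij_betw (\<theta> g) (?D (inv\<^bsub>G\<^esub> g)) (?D g)"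
      by (rule bij_betw_byWitness[where f' = "\<theta> (inv\<^bsub>G\<^esub> g)"])
        (use g \<theta>_inv \<theta>_inv' \<theta>_range in auto)
    then show ?thesis
      using g \<theta>_range \<theta>_mult \<theta>_add \<theta>_smult \<theta>_unit
      by (auto simp: algebra_iso_def ring_iso_def ring_hom_def pdom_algebra_def pdom)
  qed
  have image: "\<theta> g ` ?P (inv\<^bsub>G\<^esub> g) h = ?P g (g \<otimes>\<^bsub>G\<^esub> h)"
    if g: "g \<in> carrier G" and h: "h \<in> carrier G" for g h
  proof (rule equalityI)
    show "\<theta> g ` ?P (inv\<^bsub>G\<^esub> g) h \<subseteq> ?P g (g \<otimes>\<^bsub>G\<^esub> h)"
      using \<theta>_prod[OF g h] by blast
    show "?P g (g \<otimes>\<^bsub>G\<^esub> h) \<subseteq> \<theta> g ` ?P (inv\<^bsub>G\<^esub> g) h"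
    proof
      fix b assume b: "b \<in> ?P g (g \<otimes>\<^bsub>G\<^esub> h)"
      have "inv\<^bsub>G\<^esub> g \<otimes>\<^bsub>G\<^esub> (g \<otimes>\<^bsub>G\<^esub> h) = h"
        using g h by (simp add: G.m_assoc[symmetric])
      then have "\<theta> (inv\<^bsub>G\<^esub> g) b \<in> ?P (inv\<^bsub>G\<^esub> g) h"
        using \<theta>_prod[of "inv\<^bsub>G\<^esub> g" "g \<otimes>\<^bsub>G\<^esub> h" b] b g h by simp
      moreover have "\<theta> g (\<theta> (inv\<^bsub>G\<^esub> g) b) = b"
        using \<theta>_inv g b by simp
      ultimately show "b \<in> \<theta> g ` ?P (inv\<^bsub>G\<^esub> g) h" by (metis (lifting) image_eqI)
    qed
  qed
  have compose: "\<theta> g (\<theta> h a) = \<theta> (g \<otimes>\<^bsub>G\<^esub> h) a"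
    if g: "g \<in> carrier G" and h: "h \<in> carrier G" and a: "a \<in> ?P (inv\<^bsub>G\<^esub> h) (inv\<^bsub>G\<^esub> (g \<otimes>\<^bsub>G\<^esub> h))" for g h a
  proof -
    have "g \<otimes>\<^bsub>G\<^esub> h \<otimes>\<^bsub>G\<^esub> inv\<^bsub>G\<^esub> h = g"
      using g h by (simp add: G.m_assoc)
    then have "e g \<otimes>\<^bsub>A\<^esub> \<theta> (g \<otimes>\<^bsub>G\<^esub> h) a = \<theta> (g \<otimes>\<^bsub>G\<^esub> h) a"
      using \<theta>_prod[of "g \<otimes>\<^bsub>G\<^esub> h" "inv\<^bsub>G\<^esub> h" a] g h a by simp
    then show ?thesis
      using \<theta>_\<theta> g h a by simp
  qed
  show ?thesis
    unfolding unital_partial_action_def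
  proof (intro conjI ballI)
    show "pdom A e \<one>\<^bsub>G\<^esub> = carrier A"
      by (auto simp: pdom e_one)
  next
    fix g h assume g: "g \<in> carrier G" and h: "h \<in> carrier G"
    then show "\<theta> g ` ideal_prod A (pdom A e (inv\<^bsub>G\<^esub> g)) (pdom A e h) =
        ideal_prod A (pdom A e g) (pdom A e (g \<otimes>\<^bsub>G\<^esub> h))"
      using image by (simp add: prod)
    fix a assume "a \<in> ideal_prod A (pdom A e (inv\<^bsub>G\<^esub> h)) (pdom A e (inv\<^bsub>G\<^esub> (g \<otimes>\<^bsub>G\<^esub> h)))"
    then show "\<theta> g (\<theta> h a) = \<theta> (g \<otimes>\<^bsub>G\<^esub> h) a"
      using compose[OF g h] prod g h by simp
  qed (rule e_central e_closed e_idem iso \<theta>_one; assumption)+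
qed

section \<open>Valued twists are locally trivial\<close>

text \<open>
Since \<open>\<theta>\<^sub>g\<close> sends \<open>1\<^bsub>g\<inverse>\<^esub> 1\<^sub>h\<close> to \<open>1\<^sub>g 1\<^bsub>gh\<^esub>\<close>, the twist equation expands to the scalar
cocycle identity multiplied by \<open>1\<^sub>x 1\<^sub>y 1\<^sub>z\<close>, where \<open>x = g\<close>, \<open>y = g h\<close>, \<open>z = g h t\<close>. If \<open>\<sigma> (g, h) \<noteq> 0\<close>, then \<open>E = 1\<^sub>g 1\<^bsub>gh\<^esub>\<close> is
nonzero and absorbs \<open>1\<^sub>x\<close> for every \<open>x \<in> {\<one>, g, g h}\<close>; hence all such products are nonzero and the
scalar identity holds for all \<open>x, y, z\<close> in this set.
\<close>

lemma locally_trivial_if_valued_twist: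
  fixes G :: "('g, 'm) monoid_scheme" and K :: "('k, 'n) ring_scheme"
  assumes "group G" "unital_algebra K A" and act: "unital_partial_action G K A e \<theta>"
    and twist: "valued_twist G K A e \<theta> \<sigma>"
  shows "locally_trivial G K \<sigma>"
proof -
  interpret G: group G by fact
  interpret A: unital_algebra K A by fact
  note unit = partial_action_unit[OF assms(1-3)]
  note e [simp] = unital_partial_actionD(1,2)[OF act]
  note e_comm = unital_partial_actionD(3)[OF act]
  have \<sigma>_fun: "\<sigma> \<in> carrier G \<times> carrier G \<rightarrow>\<^sub>E carrier K"
    using twist by (simp add: valued_twist_def)
  then have \<sigma> [simp]: "\<sigma> (g, h) \<in> carrier K" if "g \<in> carrier G" "h \<in> carrier G" for g h
    using that by (auto simp: PiE_def Pi_def)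
  have \<sigma>_zero: "\<sigma> (g, h) = \<zero>\<^bsub>K\<^esub> \<longleftrightarrow> e g \<otimes>\<^bsub>A\<^esub> e (g \<otimes>\<^bsub>G\<^esub> h) = \<zero>\<^bsub>A\<^esub>"
    if "g \<in> carrier G" "h \<in> carrier G" for g h
    using twist that by (simp add: valued_twist_def)
  have pdom: "pdom A e g = {a \<in> carrier A. e g \<otimes>\<^bsub>A\<^esub> a = a}" if "g \<in> carrier G" for g
    unfolding pdom_def by (rule A.A.genideal_central_idempotent[OF e[OF that] e_comm[OF that]])
  have "pdom A e \<one>\<^bsub>G\<^esub> = carrier A"
    using unital_partial_actionD(5)[OF act G.one_closed] .
  then have "\<one>\<^bsub>A\<^esub> \<in> pdom A e \<one>\<^bsub>G\<^esub>"
    by simp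
  then have e_one [simp]: "e \<one>\<^bsub>G\<^esub> = \<one>\<^bsub>A\<^esub>"
    by (simp add: pdom)
  have "twist_elt G A e \<sigma> \<one>\<^bsub>G\<^esub> \<one>\<^bsub>G\<^esub> = e \<one>\<^bsub>G\<^esub>"
    using twist by (simp add: valued_twist_def)
  then have "\<sigma> (\<one>\<^bsub>G\<^esub>, \<one>\<^bsub>G\<^esub>) \<odot>\<^bsub>A\<^esub> \<one>\<^bsub>A\<^esub> = \<one>\<^bsub>K\<^esub> \<odot>\<^bsub>A\<^esub> \<one>\<^bsub>A\<^esub>"
    by (simp add: twist_elt_def)
  then have one_one: "\<sigma> (\<one>\<^bsub>G\<^esub>, \<one>\<^bsub>G\<^esub>) = \<one>\<^bsub>K\<^esub>"
    by (rule A.smult_cancel) (simp_all add: A.one_neq_zero)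
  note [simp] = A.smult_mult_left A.smult_mult_right A.smult_assoc1[symmetric]
  have cocycle: "\<sigma> (g, h) \<otimes>\<^bsub>K\<^esub> \<sigma> (g \<otimes>\<^bsub>G\<^esub> h, t) = \<sigma> (h, t) \<otimes>\<^bsub>K\<^esub> \<sigma> (g, h \<otimes>\<^bsub>G\<^esub> t)"
    if g: "g \<in> carrier G" and h: "h \<in> carrier G" and t: "t \<in> carrier G"
      and nz: "e g \<otimes>\<^bsub>A\<^esub> e (g \<otimes>\<^bsub>G\<^esub> h) \<otimes>\<^bsub>A\<^esub> e (g \<otimes>\<^bsub>G\<^esub> h \<otimes>\<^bsub>G\<^esub> t) \<noteq> \<zero>\<^bsub>A\<^esub>" for g h t
  proof (rule A.smult_cancel[OF _ _ _ _ nz])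
    let ?gh = "g \<otimes>\<^bsub>G\<^esub> h" and ?ght = "g \<otimes>\<^bsub>G\<^esub> h \<otimes>\<^bsub>G\<^esub> t"
    let ?E = "e g \<otimes>\<^bsub>A\<^esub> e ?gh \<otimes>\<^bsub>A\<^esub> e ?ght"
    let ?p = "e (inv\<^bsub>G\<^esub> g) \<otimes>\<^bsub>A\<^esub> e h" and ?q = "e (inv\<^bsub>G\<^esub> g) \<otimes>\<^bsub>A\<^esub> e (h \<otimes>\<^bsub>G\<^esub> t)"
    have absorb: "e x \<otimes>\<^bsub>A\<^esub> (e x \<otimes>\<^bsub>A\<^esub> a) = e x \<otimes>\<^bsub>A\<^esub> a" if "x \<in> carrier G" "a \<in> carrier A" for x a
      using that by (simp add: A.A.m_assoc[symmetric])
    have swap: "e x \<otimes>\<^bsub>A\<^esub> (e y \<otimes>\<^bsub>A\<^esub> a) = e y \<otimes>\<^bsub>A\<^esub> (e x \<otimes>\<^bsub>A\<^esub> a)"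
      if "x \<in> carrier G" "y \<in> carrier G" "a \<in> carrier A" for x y a
      using that e_comm[of x "e y"] by (simp add: A.A.m_assoc[symmetric])
    have ring: "?p \<in> pdom A e (inv\<^bsub>G\<^esub> g)" "?q \<in> pdom A e (inv\<^bsub>G\<^esub> g)" "?p \<otimes>\<^bsub>A\<^esub> ?q \<in> pdom A e (inv\<^bsub>G\<^esub> g)"
      using g h t by (simp_all add: pdom A.A.m_assoc absorb)
    have "\<theta> g \<in> algebra_iso K (pdom_algebra A e (inv\<^bsub>G\<^esub> g)) (pdom_algebra A e g)"
      using unital_partial_actionD(4)[OF act g] .
    then have "\<theta> g (\<sigma> (h, t) \<odot>\<^bsub>A\<^esub> (?p \<otimes>\<^bsub>A\<^esub> ?q)) = \<sigma> (h, t) \<odot>\<^bsub>A\<^esub> (\<theta> g ?p \<otimes>\<^bsub>A\<^esub> \<theta> g ?q)"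
      using ring h t by (simp add: algebra_iso_def ring_iso_def ring_hom_def pdom_algebra_def)
    also have "\<theta> g ?p = e g \<otimes>\<^bsub>A\<^esub> e ?gh" using unit g h by simp
    also have "\<theta> g ?q = e g \<otimes>\<^bsub>A\<^esub> e ?ght" using unit[of g "h \<otimes>\<^bsub>G\<^esub> t"] g h t by (simp add: G.m_assoc)
    also have "?p \<otimes>\<^bsub>A\<^esub> ?q = e (inv\<^bsub>G\<^esub> g) \<otimes>\<^bsub>A\<^esub> (e h \<otimes>\<^bsub>A\<^esub> e (h \<otimes>\<^bsub>G\<^esub> t))"
      using g h t by (simp add: A.A.m_assoc swap absorb)
    finally have \<theta>: "\<theta> g (e (inv\<^bsub>G\<^esub> g) \<otimes>\<^bsub>A\<^esub> twist_elt G A e \<sigma> h t) =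
        \<sigma> (h, t) \<odot>\<^bsub>A\<^esub> (e g \<otimes>\<^bsub>A\<^esub> e ?gh \<otimes>\<^bsub>A\<^esub> (e g \<otimes>\<^bsub>A\<^esub> e ?ght))"
      using g h t by (simp add: twist_elt_def)
    have "\<theta> g (e (inv\<^bsub>G\<^esub> g) \<otimes>\<^bsub>A\<^esub> twist_elt G A e \<sigma> h t) \<otimes>\<^bsub>A\<^esub> twist_elt G A e \<sigma> g (h \<otimes>\<^bsub>G\<^esub> t) =
        twist_elt G A e \<sigma> g h \<otimes>\<^bsub>A\<^esub> twist_elt G A e \<sigma> ?gh t"
      using twist g h t unfolding valued_twist_def by blast
    moreover have "twist_elt G A e \<sigma> g h \<otimes>\<^bsub>A\<^esub> twist_elt G A e \<sigma> ?gh t =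
        (\<sigma> (g, h) \<otimes>\<^bsub>K\<^esub> \<sigma> (?gh, t)) \<odot>\<^bsub>A\<^esub> ?E"
      using g h t by (simp add: twist_elt_def A.A.m_assoc absorb A.m_comm)
    moreover have "\<theta> g (e (inv\<^bsub>G\<^esub> g) \<otimes>\<^bsub>A\<^esub> twist_elt G A e \<sigma> h t) \<otimes>\<^bsub>A\<^esub> twist_elt G A e \<sigma> g (h \<otimes>\<^bsub>G\<^esub> t) =
        (\<sigma> (h, t) \<otimes>\<^bsub>K\<^esub> \<sigma> (g, h \<otimes>\<^bsub>G\<^esub> t)) \<odot>\<^bsub>A\<^esub> ?E"
      unfolding \<theta> using g h t by (simp add: twist_elt_def A.A.m_assoc G.m_assoc absorb swap A.m_comm)
    ultimately show "(\<sigma> (g, h) \<otimes>\<^bsub>K\<^esub> \<sigma> (?gh, t)) \<odot>\<^bsub>A\<^esub> ?E =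
        (\<sigma> (h, t) \<otimes>\<^bsub>K\<^esub> \<sigma> (g, h \<otimes>\<^bsub>G\<^esub> t)) \<odot>\<^bsub>A\<^esub> ?E"
      by simp
  qed (use g h t in simp_all)
  have "\<exists>f. trivialization G K \<sigma> f \<and> f (\<one>\<^bsub>G\<^esub>, g) \<noteq> \<zero>\<^bsub>K\<^esub> \<and> f (g, g \<otimes>\<^bsub>G\<^esub> h) \<noteq> \<zero>\<^bsub>K\<^esub>"
    if gh: "g \<in> carrier G" "h \<in> carrier G" and nz: "\<sigma> (g, h) \<noteq> \<zero>\<^bsub>K\<^esub>" for g h
  proof -
    let ?S = "{\<one>\<^bsub>G\<^esub>, g, g \<otimes>\<^bsub>G\<^esub> h}" and ?E = "e g \<otimes>\<^bsub>A\<^esub> e (g \<otimes>\<^bsub>G\<^esub> h)"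
    have S: "?S \<subseteq> carrier G" "\<one>\<^bsub>G\<^esub> \<in> ?S" using gh by auto
    have cancel: "x \<otimes>\<^bsub>G\<^esub> (inv\<^bsub>G\<^esub> x \<otimes>\<^bsub>G\<^esub> y) = y" if "x \<in> carrier G" "y \<in> carrier G" for x y
      using that by (simp add: G.m_assoc[symmetric])
    have cancel': "inv\<^bsub>G\<^esub> x \<otimes>\<^bsub>G\<^esub> y \<otimes>\<^bsub>G\<^esub> (inv\<^bsub>G\<^esub> y \<otimes>\<^bsub>G\<^esub> z) = inv\<^bsub>G\<^esub> x \<otimes>\<^bsub>G\<^esub> z"
      if "x \<in> carrier G" "y \<in> carrier G" "z \<in> carrier G" for x y z
      using that by (simp add: G.m_assoc cancel)
    have E: "?E \<noteq> \<zero>\<^bsub>A\<^esub>" using nz \<sigma>_zero gh by simp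
    have absorb: "e x \<otimes>\<^bsub>A\<^esub> ?E = ?E" if x: "x \<in> ?S" for x
    proof -
      have "e (g \<otimes>\<^bsub>G\<^esub> h) \<otimes>\<^bsub>A\<^esub> ?E = ?E"
        using gh e_comm[of "g \<otimes>\<^bsub>G\<^esub> h" "?E"] by (simp add: A.A.m_assoc)
      moreover have "e g \<otimes>\<^bsub>A\<^esub> ?E = ?E"
        using gh by (simp add: A.A.m_assoc[symmetric])
      ultimately show ?thesis using x gh by auto
    qed
    have prod_nz: "e x \<otimes>\<^bsub>A\<^esub> e y \<otimes>\<^bsub>A\<^esub> e z \<noteq> \<zero>\<^bsub>A\<^esub>" if xyz: "x \<in> ?S" "y \<in> ?S" "z \<in> ?S" for x y z
    proof
      have [simp]: "x \<in> carrier G" "y \<in> carrier G" "z \<in> carrier G" using xyz S by auto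
      assume "e x \<otimes>\<^bsub>A\<^esub> e y \<otimes>\<^bsub>A\<^esub> e z = \<zero>\<^bsub>A\<^esub>"
      then have "e x \<otimes>\<^bsub>A\<^esub> e y \<otimes>\<^bsub>A\<^esub> e z \<otimes>\<^bsub>A\<^esub> ?E = \<zero>\<^bsub>A\<^esub>" using gh by simp
      moreover have "e x \<otimes>\<^bsub>A\<^esub> e y \<otimes>\<^bsub>A\<^esub> e z \<otimes>\<^bsub>A\<^esub> ?E = e x \<otimes>\<^bsub>A\<^esub> (e y \<otimes>\<^bsub>A\<^esub> (e z \<otimes>\<^bsub>A\<^esub> ?E))"
        using gh by (intro A.A.m_assoc[THEN trans] A.A.m_assoc) simp_all
      ultimately show False using absorb xyz E by simp
    qed
    have nonzero: "\<sigma> (x, inv\<^bsub>G\<^esub> x \<otimes>\<^bsub>G\<^esub> y) \<noteq> \<zero>\<^bsub>K\<^esub>" if xy: "x \<in> ?S" "y \<in> ?S" for x y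
    proof -
      have [simp]: "x \<in> carrier G" "y \<in> carrier G" using xy S by auto
      show ?thesis using prod_nz[OF xy S(2)] by (simp add: \<sigma>_zero cancel)
    qed
    have cocycle': "\<sigma> (x, inv\<^bsub>G\<^esub> x \<otimes>\<^bsub>G\<^esub> y) \<otimes>\<^bsub>K\<^esub> \<sigma> (y, inv\<^bsub>G\<^esub> y \<otimes>\<^bsub>G\<^esub> z) =
        \<sigma> (inv\<^bsub>G\<^esub> x \<otimes>\<^bsub>G\<^esub> y, inv\<^bsub>G\<^esub> y \<otimes>\<^bsub>G\<^esub> z) \<otimes>\<^bsub>K\<^esub> \<sigma> (x, inv\<^bsub>G\<^esub> x \<otimes>\<^bsub>G\<^esub> z)"
      if xyz: "x \<in> ?S" "y \<in> ?S" "z \<in> ?S" for x y z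
    proof -
      have [simp]: "x \<in> carrier G" "y \<in> carrier G" "z \<in> carrier G" using xyz S by auto
      show ?thesis
        using cocycle[of x "inv\<^bsub>G\<^esub> x \<otimes>\<^bsub>G\<^esub> y" "inv\<^bsub>G\<^esub> y \<otimes>\<^bsub>G\<^esub> z"] prod_nz[OF xyz]
        by (simp add: cancel cancel')
    qed
    obtain f where "trivialization G K \<sigma> f"
      and f: "\<And>x y. \<lbrakk>x \<in> ?S; y \<in> ?S\<rbrakk> \<Longrightarrow> f (x, y) \<noteq> \<zero>\<^bsub>K\<^esub>"
      using trivialization_from_base_point[OF \<open>group G\<close> A.field_axioms \<sigma>_fun S nonzero cocycle']
      by blast
    then show ?thesis using f[of "\<one>\<^bsub>G\<^esub>" g] f[of g "g \<otimes>\<^bsub>G\<^esub> h"] by auto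
  qed
  then show ?thesis
    using \<sigma>_fun one_one by (simp add: locally_trivial_def)
qed

section \<open>Algebras generated by linear operators\<close>

text \<open>
The algebra of operators generated by a family indexed by \<open>'g\<close> is the image of the type of formal
expressions. Its underlying set may be taken inside that type by picking a representative of each
class of expressions that define the same operator. A scalar outside the carrier of \<open>K\<close> has to be
given a linear action as well, and acts as zero.
\<close>

locale operator_family = field K + module K V
  for K :: "('k, 'n) ring_scheme" (structure) and V :: "('k, 'v, 'w) module_scheme" (structure) +
  fixes T :: "'g \<Rightarrow> 'v \<Rightarrow> 'v"
  assumes T_closed [simp]: "v \<in> carrier V \<Longrightarrow> T g v \<in> carrier V"
    and T_add: "\<lbrakk>v \<in> carrier V; w \<in> carrier V\<rbrakk> \<Longrightarrow> T g (v \<oplus>\<^bsub>V\<^esub> w) = T g v \<oplus>\<^bsub>V\<^esub> T g w"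
    and T_smult: "\<lbrakk>c \<in> carrier K; v \<in> carrier V\<rbrakk> \<Longrightarrow> T g (c \<odot>\<^bsub>V\<^esub> v) = c \<odot>\<^bsub>V\<^esub> T g v"
    and nontrivial: "carrier V \<noteq> {\<zero>\<^bsub>V\<^esub>}"
begin

primrec act :: "('g, 'k) alg_expr \<Rightarrow> 'v \<Rightarrow> 'v" where
  "act (Gen g) v = T g v"
| "act (Scal c) v = (if c \<in> carrier K then c \<odot>\<^bsub>V\<^esub> v else \<zero>\<^bsub>V\<^esub>)"
| "act (Add x y) v = act x v \<oplus>\<^bsub>V\<^esub> act y v"
| "act (Mul x y) v = act x (act y v)"

definition rep :: "('g, 'k) alg_expr \<Rightarrow> ('g, 'k) alg_expr" where
  "rep x = (SOME y. \<forall>v\<in>carrier V. act y v = act x v)"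

definition op_algebra :: "('k, ('g, 'k) alg_expr) module" where
  "op_algebra = \<lparr>carrier = range rep, monoid.mult = (\<lambda>x y. rep (Mul x y)), one = rep (Scal \<one>\<^bsub>K\<^esub>),
     ring.zero = rep (Scal \<zero>\<^bsub>K\<^esub>), ring.add = (\<lambda>x y. rep (Add x y)), smult = (\<lambda>c x. rep (Mul (Scal c) x))\<rparr>"

lemma act_closed [simp]: "v \<in> carrier V \<Longrightarrow> act x v \<in> carrier V"
  by (induction x arbitrary: v) auto

lemma act_add:
  "\<lbrakk>v \<in> carrier V; w \<in> carrier V\<rbrakk> \<Longrightarrow> act x (v \<oplus>\<^bsub>V\<^esub> w) = act x v \<oplus>\<^bsub>V\<^esub> act x w"
  by (induction x arbitrary: v w) (auto simp: T_add smult_r_distr M.a_ac)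

lemma act_smult:
  "\<lbrakk>c \<in> carrier K; v \<in> carrier V\<rbrakk> \<Longrightarrow> act x (c \<odot>\<^bsub>V\<^esub> v) = c \<odot>\<^bsub>V\<^esub> act x v"
  by (induction x arbitrary: v)
    (auto simp: T_smult smult_r_distr smult_assoc1[symmetric] m_comm)

lemma act_rep [simp]: "v \<in> carrier V \<Longrightarrow> act (rep x) v = act x v"
  using someI[of "\<lambda>y. \<forall>v\<in>carrier V. act y v = act x v" x] by (simp add: rep_def)

lemma rep_cong: "(\<And>v. v \<in> carrier V \<Longrightarrow> act x v = act y v) \<Longrightarrow> rep x = rep y"
  by (simp add: rep_def)

lemma rep_in_carrier [simp]: "rep x \<in> carrier op_algebra"
  by (simp add: op_algebra_def)

text \<open>
The action is faithful, so every identity in the algebra may be checked on vectors.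
\<close>

lemma op_algebra_eqI:
  assumes "x \<in> carrier op_algebra" "y \<in> carrier op_algebra"
    and "\<And>v. v \<in> carrier V \<Longrightarrow> act x v = act y v"
  shows "x = y"
proof -
  obtain a b where ab: "x = rep a" "y = rep b"
    using assms(1,2) by (auto simp: op_algebra_def)
  have "rep a = rep b"
    using assms(3) by (intro rep_cong) (simp add: ab)
  then show ?thesis by (simp add: ab)
qed

lemma op_algebra_closed [simp]:
  "x \<otimes>\<^bsub>op_algebra\<^esub> y \<in> carrier op_algebra"
  "x \<oplus>\<^bsub>op_algebra\<^esub> y \<in> carrier op_algebra"
  "c \<odot>\<^bsub>op_algebra\<^esub> x \<in> carrier op_algebra"
  "\<one>\<^bsub>op_algebra\<^esub> \<in> carrier op_algebra"
  "\<zero>\<^bsub>op_algebra\<^esub> \<in> carrier op_algebra"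
  by (simp_all add: op_algebra_def)

lemma act_op_algebra [simp]:
  assumes "v \<in> carrier V"
  shows "act (x \<otimes>\<^bsub>op_algebra\<^esub> y) v = act x (act y v)"
    and "act (x \<oplus>\<^bsub>op_algebra\<^esub> y) v = act x v \<oplus>\<^bsub>V\<^esub> act y v"
    and "act \<one>\<^bsub>op_algebra\<^esub> v = v"
    and "act \<zero>\<^bsub>op_algebra\<^esub> v = \<zero>\<^bsub>V\<^esub>"
    and "c \<in> carrier K \<Longrightarrow> act (c \<odot>\<^bsub>op_algebra\<^esub> x) v = c \<odot>\<^bsub>V\<^esub> act x v"
  using assms by (simp_all add: op_algebra_def)

lemma op_algebra_unital_algebra: "unital_algebra K op_algebra"
proof -
  have "abelian_group op_algebra"
  proof (rule abelian_groupI)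
    fix x assume x: "x \<in> carrier op_algebra"
    show "\<exists>y\<in>carrier op_algebra. y \<oplus>\<^bsub>op_algebra\<^esub> x = \<zero>\<^bsub>op_algebra\<^esub>"
    proof (rule bexI[of _ "(\<ominus>\<^bsub>K\<^esub> \<one>\<^bsub>K\<^esub>) \<odot>\<^bsub>op_algebra\<^esub> x"])
      show "(\<ominus>\<^bsub>K\<^esub> \<one>\<^bsub>K\<^esub>) \<odot>\<^bsub>op_algebra\<^esub> x \<oplus>\<^bsub>op_algebra\<^esub> x = \<zero>\<^bsub>op_algebra\<^esub>"
        by (rule op_algebra_eqI) (simp_all add: smult_l_minus M.l_neg)
    qed simp
  qed (auto intro!: op_algebra_eqI simp: M.a_ac)
  moreover have "monoid op_algebra"
    by (rule monoidI) (auto intro!: op_algebra_eqI)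
  ultimately have "ring op_algebra"
    by (rule ringI) (auto intro!: op_algebra_eqI simp: act_add)
  moreover have "module K op_algebra"
    by (rule moduleI)
      (auto intro!: op_algebra_eqI \<open>abelian_group op_algebra\<close> is_cring
        simp: smult_l_distr smult_r_distr smult_assoc1)
  moreover have "\<one>\<^bsub>op_algebra\<^esub> \<noteq> \<zero>\<^bsub>op_algebra\<^esub>"
  proof
    assume eq: "\<one>\<^bsub>op_algebra\<^esub> = \<zero>\<^bsub>op_algebra\<^esub>"
    have "v = \<zero>\<^bsub>V\<^esub>" if "v \<in> carrier V" for v
      using act_op_algebra(3)[OF that] act_op_algebra(4)[OF that] by (simp add: eq)
    then show False using nontrivial by auto
  qed
  ultimately show ?thesis
    by (intro unital_algebra.intro unital_algebra_axioms.intro)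
      (auto intro!: op_algebra_eqI field_axioms simp: act_smult)
qed

end

section \<open>Functions on the set of trivializations\<close>

definition function_module :: "('k, 'n) ring_scheme \<Rightarrow> 'p set \<Rightarrow> ('k, 'p \<Rightarrow> 'k) module" where
  "function_module K P = \<lparr>carrier = P \<rightarrow>\<^sub>E carrier K,
     monoid.mult = (\<lambda>v w. \<lambda>p\<in>P. v p \<otimes>\<^bsub>K\<^esub> w p), one = (\<lambda>p\<in>P. \<one>\<^bsub>K\<^esub>),
     ring.zero = (\<lambda>p\<in>P. \<zero>\<^bsub>K\<^esub>), ring.add = (\<lambda>v w. \<lambda>p\<in>P. v p \<oplus>\<^bsub>K\<^esub> w p),
     smult = (\<lambda>c v. \<lambda>p\<in>P. c \<otimes>\<^bsub>K\<^esub> v p)\<rparr>"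

lemma function_module_simps [simp]:
  "carrier (function_module K P) = P \<rightarrow>\<^sub>E carrier K"
  "\<zero>\<^bsub>function_module K P\<^esub> = (\<lambda>p\<in>P. \<zero>\<^bsub>K\<^esub>)"
  "v \<oplus>\<^bsub>function_module K P\<^esub> w = (\<lambda>p\<in>P. v p \<oplus>\<^bsub>K\<^esub> w p)"
  "c \<odot>\<^bsub>function_module K P\<^esub> v = (\<lambda>p\<in>P. c \<otimes>\<^bsub>K\<^esub> v p)"
  by (simp_all add: function_module_def)

lemma (in cring) function_module_is_module: "module R (function_module R P)"
proof -
  have [simp]: "v p \<in> carrier R" if "v \<in> P \<rightarrow>\<^sub>E carrier R" "p \<in> P" for v p
    using that by (rule PiE_mem)
  have [simp]: "v p = undefined" if "v \<in> P \<rightarrow>\<^sub>E carrier R" "p \<notin> P" for v p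
    using that by (rule PiE_arb)
  have "abelian_group (function_module R P)"
  proof (rule abelian_groupI)
    fix v assume v: "v \<in> carrier (function_module R P)"
    show "\<exists>w\<in>carrier (function_module R P).
        w \<oplus>\<^bsub>function_module R P\<^esub> v = \<zero>\<^bsub>function_module R P\<^esub>"
      using v by (intro bexI[of _ "\<lambda>p\<in>P. \<ominus> v p"])
        (auto simp: l_neg intro!: restrict_ext)
  qed (auto simp: a_ac intro!: restrict_ext PiE_ext)
  then show ?thesis
    by (intro moduleI is_cring)
      (auto simp: l_distr r_distr m_assoc intro!: restrict_ext PiE_ext)
qed

locale locally_trivial_cocycle = G: group G + K: field K
  for G :: "('g, 'm) monoid_scheme" (structure) and K :: "('k, 'n) ring_scheme" (structure) +
  fixes \<sigma> :: "'g \<times> 'g \<Rightarrow> 'k"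
  assumes locally_trivial: "locally_trivial G K \<sigma>"
begin

abbreviation points :: "('g \<times> 'g \<Rightarrow> 'k) set" where
  "points \<equiv> {p. trivialization G K \<sigma> p}"

abbreviation fun_space :: "('k, ('g \<times> 'g \<Rightarrow> 'k) \<Rightarrow> 'k) module" where
  "fun_space \<equiv> function_module K points"

definition shift :: "'g \<Rightarrow> ('g \<times> 'g \<Rightarrow> 'k) \<Rightarrow> 'g \<times> 'g \<Rightarrow> 'k" where
  "shift g p = (\<lambda>(x, y)\<in>carrier G \<times> carrier G. p (g \<otimes>\<^bsub>G\<^esub> x, g \<otimes>\<^bsub>G\<^esub> y))"

lemma \<sigma>_fun: "\<sigma> \<in> carrier G \<times> carrier G \<rightarrow>\<^sub>E carrier K"
  and \<sigma>_one_one: "\<sigma> (\<one>\<^bsub>G\<^esub>, \<one>\<^bsub>G\<^esub>) = \<one>\<^bsub>K\<^esub>"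
  using locally_trivial by (simp_all add: locally_trivial_def)

lemma \<sigma>_closed [simp]: "g \<in> carrier G \<Longrightarrow> h \<in> carrier G \<Longrightarrow> \<sigma> (g, h) \<in> carrier K"
  using \<sigma>_fun by (auto simp: PiE_def Pi_def)

lemma point_on:
  assumes "g \<in> carrier G" "h \<in> carrier G" "\<sigma> (g, h) \<noteq> \<zero>\<^bsub>K\<^esub>"
  obtains p where "p \<in> points" "p (\<one>\<^bsub>G\<^esub>, g) \<noteq> \<zero>\<^bsub>K\<^esub>" "p (g, g \<otimes>\<^bsub>G\<^esub> h) \<noteq> \<zero>\<^bsub>K\<^esub>"
  using locally_trivial assms unfolding locally_trivial_def by blast

lemma points_nonempty: "points \<noteq> {}"
proof -
  have "\<sigma> (\<one>\<^bsub>G\<^esub>, \<one>\<^bsub>G\<^esub>) \<noteq> \<zero>\<^bsub>K\<^esub>" by (simp add: \<sigma>_one_one)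
  then show ?thesis using point_on[of "\<one>\<^bsub>G\<^esub>" "\<one>\<^bsub>G\<^esub>"] by blast
qed

context
  fixes p assumes p: "p \<in> points"
begin

lemma point_fun: "p \<in> carrier G \<times> carrier G \<rightarrow>\<^sub>E carrier K"
  using p by (simp add: trivialization_def)

lemma point_closed [simp]: "x \<in> carrier G \<Longrightarrow> y \<in> carrier G \<Longrightarrow> p (x, y) \<in> carrier K"
  using point_fun by (auto simp: PiE_def Pi_def)

lemma point_base: "p (\<one>\<^bsub>G\<^esub>, \<one>\<^bsub>G\<^esub>) \<noteq> \<zero>\<^bsub>K\<^esub>"
  using p by (simp add: trivialization_def)

lemma point_sym: "\<lbrakk>x \<in> carrier G; y \<in> carrier G; p (x, y) \<noteq> \<zero>\<^bsub>K\<^esub>\<rbrakk> \<Longrightarrow> p (y, x) \<noteq> \<zero>\<^bsub>K\<^esub>"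
  using p unfolding trivialization_def by blast

lemma point_trans:
  assumes "x \<in> carrier G" "y \<in> carrier G" "z \<in> carrier G" "p (x, y) \<noteq> \<zero>\<^bsub>K\<^esub>" "p (y, z) \<noteq> \<zero>\<^bsub>K\<^esub>"
  shows "p (x, z) \<noteq> \<zero>\<^bsub>K\<^esub>"
    and "p (x, y) \<otimes>\<^bsub>K\<^esub> p (y, z) =
      \<sigma> (inv\<^bsub>G\<^esub> x \<otimes>\<^bsub>G\<^esub> y, inv\<^bsub>G\<^esub> y \<otimes>\<^bsub>G\<^esub> z) \<otimes>\<^bsub>K\<^esub> p (x, z)"
  using p assms unfolding trivialization_def by blast+

lemma point_support:
  assumes "g \<in> carrier G" "x \<in> carrier G" "p (\<one>\<^bsub>G\<^esub>, g) \<noteq> \<zero>\<^bsub>K\<^esub>"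
  shows "p (g, x) \<noteq> \<zero>\<^bsub>K\<^esub> \<longleftrightarrow> p (\<one>\<^bsub>G\<^esub>, x) \<noteq> \<zero>\<^bsub>K\<^esub>"
  using assms point_sym[of "\<one>\<^bsub>G\<^esub>" g] point_trans(1)[of "\<one>\<^bsub>G\<^esub>" g x] point_trans(1)[of g "\<one>\<^bsub>G\<^esub>" x] by auto

lemma point_diagonal:
  assumes "x \<in> carrier G" "p (x, x) \<noteq> \<zero>\<^bsub>K\<^esub>"
  shows "p (x, x) = \<one>\<^bsub>K\<^esub>"
proof -
  have "p (x, x) \<otimes>\<^bsub>K\<^esub> p (x, x) = p (x, x) \<otimes>\<^bsub>K\<^esub> \<one>\<^bsub>K\<^esub>"
    using point_trans(2)[of x x x] assms by (simp add: \<sigma>_one_one)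
  then show ?thesis using K.m_lcancel[of "p (x, x)" "p (x, x)" "\<one>\<^bsub>K\<^esub>"] assms by simp
qed

text \<open>
The expressions \<open>x\<inverse> y\<close> in the coboundary equation are invariant under left translation. The condition
\<open>p (\<one>, g) \<noteq> 0\<close> ensures that the translated function is nonzero at the pair of units.
\<close>

lemma shift_in_points:
  assumes g: "g \<in> carrier G" "p (\<one>\<^bsub>G\<^esub>, g) \<noteq> \<zero>\<^bsub>K\<^esub>"
  shows "shift g p \<in> points"
proof -
  have cancel: "inv\<^bsub>G\<^esub> (g \<otimes>\<^bsub>G\<^esub> x) \<otimes>\<^bsub>G\<^esub> (g \<otimes>\<^bsub>G\<^esub> y) = inv\<^bsub>G\<^esub> x \<otimes>\<^bsub>G\<^esub> y"
    if "x \<in> carrier G" "y \<in> carrier G" for x y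
  proof -
    have "inv\<^bsub>G\<^esub> g \<otimes>\<^bsub>G\<^esub> (g \<otimes>\<^bsub>G\<^esub> y) = y"
      using g that by (simp add: G.m_assoc[symmetric])
    then show ?thesis using g that by (simp add: G.inv_mult_group G.m_assoc)
  qed
  have "shift g p \<in> carrier G \<times> carrier G \<rightarrow>\<^sub>E carrier K"
    using g by (auto simp: shift_def)
  moreover have "shift g p (\<one>\<^bsub>G\<^esub>, \<one>\<^bsub>G\<^esub>) \<noteq> \<zero>\<^bsub>K\<^esub>"
    using point_support[OF g(1) g(1) g(2)] g by (simp add: shift_def)
  moreover have "shift g p (y, x) \<noteq> \<zero>\<^bsub>K\<^esub>"
    if "x \<in> carrier G" "y \<in> carrier G" "shift g p (x, y) \<noteq> \<zero>\<^bsub>K\<^esub>" for x y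
    using that g point_sym[of "g \<otimes>\<^bsub>G\<^esub> x" "g \<otimes>\<^bsub>G\<^esub> y"] by (simp add: shift_def)
  moreover have "shift g p (x, z) \<noteq> \<zero>\<^bsub>K\<^esub> \<and> shift g p (x, y) \<otimes>\<^bsub>K\<^esub> shift g p (y, z) =
      \<sigma> (inv\<^bsub>G\<^esub> x \<otimes>\<^bsub>G\<^esub> y, inv\<^bsub>G\<^esub> y \<otimes>\<^bsub>G\<^esub> z) \<otimes>\<^bsub>K\<^esub> shift g p (x, z)"
    if "x \<in> carrier G" "y \<in> carrier G" "z \<in> carrier G"
      "shift g p (x, y) \<noteq> \<zero>\<^bsub>K\<^esub>" "shift g p (y, z) \<noteq> \<zero>\<^bsub>K\<^esub>" for x y z
    using that g point_trans[of "g \<otimes>\<^bsub>G\<^esub> x" "g \<otimes>\<^bsub>G\<^esub> y" "g \<otimes>\<^bsub>G\<^esub> z"] by (simp add: shift_def cancel)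
  ultimately show ?thesis
    unfolding trivialization_def by blast
qed

lemma shift_one: "shift \<one>\<^bsub>G\<^esub> p = p"
  using point_fun by (auto simp: shift_def PiE_def extensional_def fun_eq_iff)

end

lemma shift_apply:
  "\<lbrakk>x \<in> carrier G; y \<in> carrier G\<rbrakk> \<Longrightarrow> shift g p (x, y) = p (g \<otimes>\<^bsub>G\<^esub> x, g \<otimes>\<^bsub>G\<^esub> y)"
  by (simp add: shift_def)

lemma shift_shift:
  "\<lbrakk>g \<in> carrier G; h \<in> carrier G\<rbrakk> \<Longrightarrow> shift h (shift g p) = shift (g \<otimes>\<^bsub>G\<^esub> h) p"
  by (auto simp: shift_def fun_eq_iff G.m_assoc)

text \<open>
The coboundary equation for the triangle \<open>\<one>, g, g h\<close>. This is where the values of \<open>\<sigma>\<close> enter both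
constructions.
\<close>

lemma point_triangle:
  assumes "p \<in> points" "g \<in> carrier G" "h \<in> carrier G"
    and "p (\<one>\<^bsub>G\<^esub>, g) \<noteq> \<zero>\<^bsub>K\<^esub>" "p (\<one>\<^bsub>G\<^esub>, g \<otimes>\<^bsub>G\<^esub> h) \<noteq> \<zero>\<^bsub>K\<^esub>"
  shows "p (\<one>\<^bsub>G\<^esub>, g) \<otimes>\<^bsub>K\<^esub> p (g, g \<otimes>\<^bsub>G\<^esub> h) = \<sigma> (g, h) \<otimes>\<^bsub>K\<^esub> p (\<one>\<^bsub>G\<^esub>, g \<otimes>\<^bsub>G\<^esub> h)"
    and "\<sigma> (g, h) \<noteq> \<zero>\<^bsub>K\<^esub>"
proof -
  have gh: "p (g, g \<otimes>\<^bsub>G\<^esub> h) \<noteq> \<zero>\<^bsub>K\<^esub>"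
    using point_support[OF assms(1), of g "g \<otimes>\<^bsub>G\<^esub> h"] assms by simp
  show eq: "p (\<one>\<^bsub>G\<^esub>, g) \<otimes>\<^bsub>K\<^esub> p (g, g \<otimes>\<^bsub>G\<^esub> h) = \<sigma> (g, h) \<otimes>\<^bsub>K\<^esub> p (\<one>\<^bsub>G\<^esub>, g \<otimes>\<^bsub>G\<^esub> h)"
    using point_trans(2)[OF assms(1) _ _ _ assms(4) gh] assms(2,3)
    by (simp add: G.m_assoc[symmetric])
  show "\<sigma> (g, h) \<noteq> \<zero>\<^bsub>K\<^esub>"
  proof
    assume "\<sigma> (g, h) = \<zero>\<^bsub>K\<^esub>"
    then have "p (\<one>\<^bsub>G\<^esub>, g) \<otimes>\<^bsub>K\<^esub> p (g, g \<otimes>\<^bsub>G\<^esub> h) = \<zero>\<^bsub>K\<^esub>"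
      using eq assms(1-3) by simp
    then show False
      using K.integral_iff[of "p (\<one>\<^bsub>G\<^esub>, g)" "p (g, g \<otimes>\<^bsub>G\<^esub> h)"] assms gh by simp
  qed
qed

lemma point_support_shift:
  assumes "p \<in> points" "g \<in> carrier G" "p (\<one>\<^bsub>G\<^esub>, g) \<noteq> \<zero>\<^bsub>K\<^esub>" "h \<in> carrier G"
  shows "p (g, g \<otimes>\<^bsub>G\<^esub> h) = \<zero>\<^bsub>K\<^esub> \<longleftrightarrow> p (\<one>\<^bsub>G\<^esub>, g \<otimes>\<^bsub>G\<^esub> h) = \<zero>\<^bsub>K\<^esub>"
  using point_support[OF assms(1,2) _ assms(3), of "g \<otimes>\<^bsub>G\<^esub> h"] assms(2,4) by simp

text \<open>
The product of the three weights along the path \<open>\<one>, g, g h, g h t\<close> can be contracted in two ways; the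
weight of the edge from \<open>\<one>\<close> to \<open>g h t\<close> cancels.
\<close>

lemma point_cocycle:
  assumes p: "p \<in> points" and g: "g \<in> carrier G" and h: "h \<in> carrier G" and t: "t \<in> carrier G"
    and nz: "p (\<one>\<^bsub>G\<^esub>, g) \<noteq> \<zero>\<^bsub>K\<^esub>" "p (\<one>\<^bsub>G\<^esub>, g \<otimes>\<^bsub>G\<^esub> h) \<noteq> \<zero>\<^bsub>K\<^esub>"
      "p (\<one>\<^bsub>G\<^esub>, g \<otimes>\<^bsub>G\<^esub> (h \<otimes>\<^bsub>G\<^esub> t)) \<noteq> \<zero>\<^bsub>K\<^esub>"
  shows "\<sigma> (h, t) \<otimes>\<^bsub>K\<^esub> \<sigma> (g, h \<otimes>\<^bsub>G\<^esub> t) = \<sigma> (g, h) \<otimes>\<^bsub>K\<^esub> \<sigma> (g \<otimes>\<^bsub>G\<^esub> h, t)"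
proof -
  let ?gh = "g \<otimes>\<^bsub>G\<^esub> h" and ?ght = "g \<otimes>\<^bsub>G\<^esub> (h \<otimes>\<^bsub>G\<^esub> t)" and ?q = "shift g p"
  have q: "?q \<in> points" using shift_in_points p g nz(1) by blast
  have q_nz: "?q (\<one>\<^bsub>G\<^esub>, h) \<noteq> \<zero>\<^bsub>K\<^esub>" "?q (\<one>\<^bsub>G\<^esub>, h \<otimes>\<^bsub>G\<^esub> t) \<noteq> \<zero>\<^bsub>K\<^esub>"
    using nz g h t point_support_shift[OF p g nz(1)] by (simp_all add: shift_apply)
  have "p (g, ?gh) \<otimes>\<^bsub>K\<^esub> p (?gh, ?ght) = \<sigma> (h, t) \<otimes>\<^bsub>K\<^esub> p (g, ?ght)"
    using point_triangle(1)[OF q h t q_nz] g h t by (simp add: shift_apply)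
  moreover have "p (\<one>\<^bsub>G\<^esub>, g) \<otimes>\<^bsub>K\<^esub> p (g, ?ght) = \<sigma> (g, h \<otimes>\<^bsub>G\<^esub> t) \<otimes>\<^bsub>K\<^esub> p (\<one>\<^bsub>G\<^esub>, ?ght)"
    using point_triangle(1)[OF p g, of "h \<otimes>\<^bsub>G\<^esub> t"] nz h t by simp
  ultimately have "p (\<one>\<^bsub>G\<^esub>, g) \<otimes>\<^bsub>K\<^esub> (p (g, ?gh) \<otimes>\<^bsub>K\<^esub> p (?gh, ?ght)) =
      (\<sigma> (h, t) \<otimes>\<^bsub>K\<^esub> \<sigma> (g, h \<otimes>\<^bsub>G\<^esub> t)) \<otimes>\<^bsub>K\<^esub> p (\<one>\<^bsub>G\<^esub>, ?ght)"
    using g h t point_closed[OF p] by (simp add: K.m_assoc K.m_lcomm)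
  moreover have "p (\<one>\<^bsub>G\<^esub>, g) \<otimes>\<^bsub>K\<^esub> p (g, ?gh) \<otimes>\<^bsub>K\<^esub> p (?gh, ?ght) =
      (\<sigma> (g, h) \<otimes>\<^bsub>K\<^esub> \<sigma> (?gh, t)) \<otimes>\<^bsub>K\<^esub> p (\<one>\<^bsub>G\<^esub>, ?ght)"
    using point_triangle(1)[OF p g h] point_triangle(1)[OF p _ t, of ?gh] nz g h t
      point_closed[OF p] by (simp add: K.m_assoc G.m_assoc)
  ultimately show ?thesis
    using K.m_rcancel[of "p (\<one>\<^bsub>G\<^esub>, ?ght)" "\<sigma> (h, t) \<otimes>\<^bsub>K\<^esub> \<sigma> (g, h \<otimes>\<^bsub>G\<^esub> t)" "\<sigma> (g, h) \<otimes>\<^bsub>K\<^esub> \<sigma> (?gh, t)"]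
      nz g h t point_closed[OF p] by (simp add: K.m_assoc)
qed

lemma fun_space_is_module: "module K fun_space"
  by (rule K.function_module_is_module)

lemma one_function: "(\<lambda>p\<in>points. \<one>\<^bsub>K\<^esub>) \<in> carrier fun_space"
  by simp

lemma fun_space_nontrivial: "carrier fun_space \<noteq> {\<zero>\<^bsub>fun_space\<^esub>}"
proof
  assume "carrier fun_space = {\<zero>\<^bsub>fun_space\<^esub>}"
  then have "(\<lambda>p\<in>points. \<one>\<^bsub>K\<^esub>) = (\<lambda>p\<in>points. \<zero>\<^bsub>K\<^esub>)"
    using one_function by auto
  moreover obtain p where "p \<in> points" using points_nonempty by auto
  ultimately show False by (metis K.one_not_zero restrict_apply')
qed

lemma fun_space_eqI:
  assumes "v \<in> carrier fun_space" "w \<in> carrier fun_space"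
    and "\<And>p. p \<in> points \<Longrightarrow> v p = w p"
  shows "v = w"
  using assms by (auto intro: PiE_ext)

section \<open>A partial projective representation by weighted shifts\<close>

text \<open>
Without the weight \<open>p (\<one>, g)\<close> this would be an ordinary partial representation by translations; the
weight introduces the factor \<open>\<sigma>\<close>.
\<close>

definition weighted_shift :: "'g \<Rightarrow> (('g \<times> 'g \<Rightarrow> 'k) \<Rightarrow> 'k) \<Rightarrow> ('g \<times> 'g \<Rightarrow> 'k) \<Rightarrow> 'k" where
  "weighted_shift g v = (\<lambda>p\<in>points. if g \<in> carrier G \<and> p (\<one>\<^bsub>G\<^esub>, g) \<noteq> \<zero>\<^bsub>K\<^esub>
     then p (\<one>\<^bsub>G\<^esub>, g) \<otimes>\<^bsub>K\<^esub> v (shift g p) else \<zero>\<^bsub>K\<^esub>)"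

lemma weighted_shift_operators: "operator_family K fun_space weighted_shift"
proof (intro operator_family.intro operator_family_axioms.intro K.field_axioms fun_space_is_module
    fun_space_nontrivial)
  have closed: "v (shift g p) \<in> carrier K"
    if "v \<in> carrier fun_space" "p \<in> points" "g \<in> carrier G" "p (\<one>\<^bsub>G\<^esub>, g) \<noteq> \<zero>\<^bsub>K\<^esub>" for v p g
    using that shift_in_points by (metis PiE_mem function_module_simps(1))
  show "weighted_shift g v \<in> carrier fun_space" if "v \<in> carrier fun_space" for g v
    using closed[OF that] by (auto simp: weighted_shift_def)
  show "weighted_shift g (v \<oplus>\<^bsub>fun_space\<^esub> w) =
      weighted_shift g v \<oplus>\<^bsub>fun_space\<^esub> weighted_shift g w"
    if "v \<in> carrier fun_space" "w \<in> carrier fun_space" for g v w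
    using closed[OF that(1)] closed[OF that(2)] shift_in_points
    by (auto simp: weighted_shift_def K.r_distr intro!: restrict_ext)
  show "weighted_shift g (c \<odot>\<^bsub>fun_space\<^esub> v) = c \<odot>\<^bsub>fun_space\<^esub> weighted_shift g v"
    if "c \<in> carrier K" "v \<in> carrier fun_space" for g c v
    using closed[OF that(2)] shift_in_points that(1)
    by (auto simp: weighted_shift_def K.m_lcomm intro!: restrict_ext)
qed

lemma function_value [simp]:
  "v \<in> points \<rightarrow>\<^sub>E carrier K \<Longrightarrow> trivialization G K \<sigma> p \<Longrightarrow> v p \<in> carrier K"
  by (erule PiE_mem) simp

lemma weighted_shift_apply:
  "\<lbrakk>p \<in> points; g \<in> carrier G\<rbrakk> \<Longrightarrow> weighted_shift g v p =
    (if p (\<one>\<^bsub>G\<^esub>, g) \<noteq> \<zero>\<^bsub>K\<^esub> then p (\<one>\<^bsub>G\<^esub>, g) \<otimes>\<^bsub>K\<^esub> v (shift g p) else \<zero>\<^bsub>K\<^esub>)"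
  by (simp add: weighted_shift_def)

text \<open>
In operator form: \<open>\<Gamma> g \<Gamma> h = \<sigma> (g, h) 1\<^sub>g \<Gamma> (g h)\<close>, where \<open>1\<^sub>g\<close> multiplies by the indicator function of
the trivializations \<open>p\<close> with \<open>p (\<one>, g) \<noteq> 0\<close>.
\<close>

lemma weighted_shift_twice:
  assumes p: "p \<in> points" and gh: "g \<in> carrier G" "h \<in> carrier G" and v: "v \<in> carrier fun_space"
  shows "weighted_shift g (weighted_shift h v) p =
    (if p (\<one>\<^bsub>G\<^esub>, g) \<noteq> \<zero>\<^bsub>K\<^esub> then \<sigma> (g, h) \<otimes>\<^bsub>K\<^esub> weighted_shift (g \<otimes>\<^bsub>G\<^esub> h) v p else \<zero>\<^bsub>K\<^esub>)"
proof (cases "p (\<one>\<^bsub>G\<^esub>, g) = \<zero>\<^bsub>K\<^esub>")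
  case False
  let ?k = "g \<otimes>\<^bsub>G\<^esub> h"
  have "weighted_shift g (weighted_shift h v) p =
      p (\<one>\<^bsub>G\<^esub>, g) \<otimes>\<^bsub>K\<^esub> (if p (g, ?k) \<noteq> \<zero>\<^bsub>K\<^esub> then p (g, ?k) \<otimes>\<^bsub>K\<^esub> v (shift ?k p) else \<zero>\<^bsub>K\<^esub>)"
    using False p gh shift_in_points[OF p gh(1) False]
    by (simp add: weighted_shift_apply shift_apply shift_shift)
  also have "\<dots> = \<sigma> (g, h) \<otimes>\<^bsub>K\<^esub> weighted_shift ?k v p"
  proof (cases "p (\<one>\<^bsub>G\<^esub>, ?k) = \<zero>\<^bsub>K\<^esub>")
    case True
    then show ?thesis
      using point_support[OF p gh(1), of ?k] False p gh by (simp add: weighted_shift_apply)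
  next
    case k: False
    have "v (shift ?k p) \<in> carrier K"
      using shift_in_points[OF p _ k] gh v by simp
    then show ?thesis
      using point_support[OF p gh(1), of ?k] point_triangle(1)[OF p gh False k] False k p gh
        point_closed[OF p]
      by (simp add: weighted_shift_apply K.m_assoc[symmetric])
  qed
  finally show ?thesis using False by simp
qed (use p gh in \<open>simp add: weighted_shift_apply\<close>)

interpretation R: operator_family K fun_space weighted_shift
  by (rule weighted_shift_operators)

lemma factor_set_of_weighted_shifts:
  "factor_set G K R.op_algebra (\<lambda>g. R.rep (Gen g)) \<sigma>"
proof -
  let ?\<Gamma> = "\<lambda>g. R.rep (Gen g)"
  let ?W = weighted_shift
  note W_closed = R.T_closed
  have eqI: "x = y"
    if "x \<in> carrier R.op_algebra" "y \<in> carrier R.op_algebra"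
      and "\<And>v p. \<lbrakk>v \<in> carrier fun_space; p \<in> points\<rbrakk> \<Longrightarrow> R.act x v p = R.act y v p" for x y
    using that by (intro R.op_algebra_eqI fun_space_eqI) (auto simp del: function_module_simps)
  have zero: "R.act \<zero>\<^bsub>R.op_algebra\<^esub> v p = \<zero>\<^bsub>K\<^esub>" if "v \<in> carrier fun_space" "p \<in> points" for v p
    using R.act_op_algebra(4)[OF that(1)] that(2) by simp
  have smult: "R.act (c \<odot>\<^bsub>R.op_algebra\<^esub> x) v p = c \<otimes>\<^bsub>K\<^esub> R.act x v p"
    if "c \<in> carrier K" "v \<in> carrier fun_space" "p \<in> points" for c x v p
    using R.act_op_algebra(5)[OF that(2,1)] that(3) by simp
  have \<Gamma>2: "R.act (?\<Gamma> g \<otimes>\<^bsub>R.op_algebra\<^esub> ?\<Gamma> h) v p = ?W g (?W h v) p"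
    if "v \<in> carrier fun_space" for g h v p
    using that by (simp del: function_module_simps)
  have \<Gamma>3: "R.act (?\<Gamma> g \<otimes>\<^bsub>R.op_algebra\<^esub> ?\<Gamma> h \<otimes>\<^bsub>R.op_algebra\<^esub> ?\<Gamma> t) v p = ?W g (?W h (?W t v)) p"
    if "v \<in> carrier fun_space" for g h t v p
    using that by (simp del: function_module_simps)
  have W_value: "?W g v p \<in> carrier K" if "v \<in> carrier fun_space" "p \<in> points" for g v p
    using W_closed[OF that(1)] that(2) by simp
  \<comment> \<open>Translation takes the triangle \<open>g\<inverse>, \<one>, h\<close> to the triangle \<open>\<one>, g, g h\<close>.\<close>
  have \<sigma>_shifted: "\<sigma> (g, h) \<noteq> \<zero>\<^bsub>K\<^esub>"
    if p: "p \<in> points" and gh: "g \<in> carrier G" "h \<in> carrier G"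
      and nz: "p (\<one>\<^bsub>G\<^esub>, inv\<^bsub>G\<^esub> g) \<noteq> \<zero>\<^bsub>K\<^esub>" "p (\<one>\<^bsub>G\<^esub>, h) \<noteq> \<zero>\<^bsub>K\<^esub>" for p g h
    using point_triangle(2)[OF shift_in_points[OF p _ nz(1)] gh] gh nz
      point_support[OF p _ _ nz(1)] point_base[OF p]
    by (simp add: shift_apply G.m_assoc[symmetric])
  have zero_l: "?\<Gamma> (inv\<^bsub>G\<^esub> g) \<otimes>\<^bsub>R.op_algebra\<^esub> ?\<Gamma> (g \<otimes>\<^bsub>G\<^esub> h) = \<zero>\<^bsub>R.op_algebra\<^esub>"
    if g: "g \<in> carrier G" and h: "h \<in> carrier G" and \<sigma>0: "\<sigma> (g, h) = \<zero>\<^bsub>K\<^esub>" for g h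
  proof (rule eqI)
    fix v p assume v: "v \<in> carrier fun_space" and p: "p \<in> points"
    have "?W (inv\<^bsub>G\<^esub> g) (?W (g \<otimes>\<^bsub>G\<^esub> h) v) p =
        (if p (\<one>\<^bsub>G\<^esub>, inv\<^bsub>G\<^esub> g) \<noteq> \<zero>\<^bsub>K\<^esub> then \<sigma> (inv\<^bsub>G\<^esub> g, g \<otimes>\<^bsub>G\<^esub> h) \<otimes>\<^bsub>K\<^esub> ?W h v p else \<zero>\<^bsub>K\<^esub>)"
      using g h p v by (subst weighted_shift_twice) (simp_all add: G.m_assoc[symmetric])
    moreover have "?W h v p = \<zero>\<^bsub>K\<^esub>" if "p (\<one>\<^bsub>G\<^esub>, inv\<^bsub>G\<^esub> g) \<noteq> \<zero>\<^bsub>K\<^esub>"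
      using \<sigma>_shifted[OF p g h that] \<sigma>0 p h by (auto simp: weighted_shift_apply)
    ultimately have "?W (inv\<^bsub>G\<^esub> g) (?W (g \<otimes>\<^bsub>G\<^esub> h) v) p = \<zero>\<^bsub>K\<^esub>"
      using g h by simp
    then show "R.act (?\<Gamma> (inv\<^bsub>G\<^esub> g) \<otimes>\<^bsub>R.op_algebra\<^esub> ?\<Gamma> (g \<otimes>\<^bsub>G\<^esub> h)) v p =
        R.act \<zero>\<^bsub>R.op_algebra\<^esub> v p"
      using v p by (simp only: \<Gamma>2 zero)
  qed simp_all
  have swap_r: "?W (g \<otimes>\<^bsub>G\<^esub> h) (?W (inv\<^bsub>G\<^esub> h) v) p = \<zero>\<^bsub>K\<^esub>"
    if v: "v \<in> carrier fun_space" and p: "p \<in> points" and g: "g \<in> carrier G" and h: "h \<in> carrier G"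
      and "\<sigma> (g, h) = \<zero>\<^bsub>K\<^esub> \<or> p (\<one>\<^bsub>G\<^esub>, g) = \<zero>\<^bsub>K\<^esub>" for v p g h
  proof -
    have "?W (g \<otimes>\<^bsub>G\<^esub> h) (?W (inv\<^bsub>G\<^esub> h) v) p =
        (if p (\<one>\<^bsub>G\<^esub>, g \<otimes>\<^bsub>G\<^esub> h) \<noteq> \<zero>\<^bsub>K\<^esub> then \<sigma> (g \<otimes>\<^bsub>G\<^esub> h, inv\<^bsub>G\<^esub> h) \<otimes>\<^bsub>K\<^esub> ?W g v p else \<zero>\<^bsub>K\<^esub>)"
      using g h p v by (subst weighted_shift_twice) (simp_all add: G.m_assoc)
    moreover have "?W g v p = \<zero>\<^bsub>K\<^esub>" if "p (\<one>\<^bsub>G\<^esub>, g \<otimes>\<^bsub>G\<^esub> h) \<noteq> \<zero>\<^bsub>K\<^esub>"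
      using point_triangle(2)[OF p g h _ that] \<open>_ \<or> _\<close> p g by (auto simp: weighted_shift_apply)
    ultimately show ?thesis using g h by simp
  qed
  have zero_r: "?\<Gamma> (g \<otimes>\<^bsub>G\<^esub> h) \<otimes>\<^bsub>R.op_algebra\<^esub> ?\<Gamma> (inv\<^bsub>G\<^esub> h) = \<zero>\<^bsub>R.op_algebra\<^esub>"
    if "g \<in> carrier G" "h \<in> carrier G" "\<sigma> (g, h) = \<zero>\<^bsub>K\<^esub>" for g h
  proof (rule eqI)
    fix v p assume v: "v \<in> carrier fun_space" and p: "p \<in> points"
    then show "R.act (?\<Gamma> (g \<otimes>\<^bsub>G\<^esub> h) \<otimes>\<^bsub>R.op_algebra\<^esub> ?\<Gamma> (inv\<^bsub>G\<^esub> h)) v p =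
        R.act \<zero>\<^bsub>R.op_algebra\<^esub> v p"
      using swap_r[OF v p that(1,2) disjI1[OF that(3)]] by (simp only: \<Gamma>2 zero)
  qed simp_all
  have rel_l: "?\<Gamma> (inv\<^bsub>G\<^esub> g) \<otimes>\<^bsub>R.op_algebra\<^esub> ?\<Gamma> g \<otimes>\<^bsub>R.op_algebra\<^esub> ?\<Gamma> h =
      \<sigma> (g, h) \<odot>\<^bsub>R.op_algebra\<^esub> (?\<Gamma> (inv\<^bsub>G\<^esub> g) \<otimes>\<^bsub>R.op_algebra\<^esub> ?\<Gamma> (g \<otimes>\<^bsub>G\<^esub> h))"
    if g: "g \<in> carrier G" and h: "h \<in> carrier G" for g h
  proof (rule eqI)
    fix v p assume v: "v \<in> carrier fun_space" and p: "p \<in> points"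
    have "?W (inv\<^bsub>G\<^esub> g) (?W g (?W h v)) p = \<sigma> (g, h) \<otimes>\<^bsub>K\<^esub> ?W (inv\<^bsub>G\<^esub> g) (?W (g \<otimes>\<^bsub>G\<^esub> h) v) p"
    proof (cases "p (\<one>\<^bsub>G\<^esub>, inv\<^bsub>G\<^esub> g) = \<zero>\<^bsub>K\<^esub>")
      case True
      then show ?thesis using p g h by (simp add: weighted_shift_apply[of p "inv\<^bsub>G\<^esub> g"])
    next
      case False
      let ?q = "shift (inv\<^bsub>G\<^esub> g) p"
      have q: "?q \<in> points" using shift_in_points[OF p _ False] g by simp
      have "?q (\<one>\<^bsub>G\<^esub>, g) \<noteq> \<zero>\<^bsub>K\<^esub>"
        using point_support[OF p _ _ False, of "\<one>\<^bsub>G\<^esub>"] point_base[OF p] g by (simp add: shift_apply)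
      then have "?W g (?W h v) ?q = \<sigma> (g, h) \<otimes>\<^bsub>K\<^esub> ?W (g \<otimes>\<^bsub>G\<^esub> h) v ?q"
        using weighted_shift_twice[OF q g h v] by simp
      moreover have "?W (inv\<^bsub>G\<^esub> g) u p = p (\<one>\<^bsub>G\<^esub>, inv\<^bsub>G\<^esub> g) \<otimes>\<^bsub>K\<^esub> u ?q" for u
        using False p g by (simp add: weighted_shift_apply)
      ultimately show ?thesis
        using W_value[OF v q] p g h point_closed[OF p] by (simp add: K.m_lcomm)
    qed
    then show "R.act (?\<Gamma> (inv\<^bsub>G\<^esub> g) \<otimes>\<^bsub>R.op_algebra\<^esub> ?\<Gamma> g \<otimes>\<^bsub>R.op_algebra\<^esub> ?\<Gamma> h) v p =
        R.act (\<sigma> (g, h) \<odot>\<^bsub>R.op_algebra\<^esub>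
          (?\<Gamma> (inv\<^bsub>G\<^esub> g) \<otimes>\<^bsub>R.op_algebra\<^esub> ?\<Gamma> (g \<otimes>\<^bsub>G\<^esub> h))) v p"
      using v p g h by (simp only: \<Gamma>2 \<Gamma>3 smult \<sigma>_closed)
  qed simp_all
  have rel_r: "?\<Gamma> g \<otimes>\<^bsub>R.op_algebra\<^esub> ?\<Gamma> h \<otimes>\<^bsub>R.op_algebra\<^esub> ?\<Gamma> (inv\<^bsub>G\<^esub> h) =
      \<sigma> (g, h) \<odot>\<^bsub>R.op_algebra\<^esub> (?\<Gamma> (g \<otimes>\<^bsub>G\<^esub> h) \<otimes>\<^bsub>R.op_algebra\<^esub> ?\<Gamma> (inv\<^bsub>G\<^esub> h))"
    if g: "g \<in> carrier G" and h: "h \<in> carrier G" for g h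
  proof (rule eqI)
    fix v p assume v: "v \<in> carrier fun_space" and p: "p \<in> points"
    have "?W g (?W h (?W (inv\<^bsub>G\<^esub> h) v)) p =
        \<sigma> (g, h) \<otimes>\<^bsub>K\<^esub> ?W (g \<otimes>\<^bsub>G\<^esub> h) (?W (inv\<^bsub>G\<^esub> h) v) p"
      using weighted_shift_twice[OF p g h W_closed[OF v]] swap_r[OF v p g h] g h by auto
    then show "R.act (?\<Gamma> g \<otimes>\<^bsub>R.op_algebra\<^esub> ?\<Gamma> h \<otimes>\<^bsub>R.op_algebra\<^esub> ?\<Gamma> (inv\<^bsub>G\<^esub> h)) v p =
        R.act (\<sigma> (g, h) \<odot>\<^bsub>R.op_algebra\<^esub>
          (?\<Gamma> (g \<otimes>\<^bsub>G\<^esub> h) \<otimes>\<^bsub>R.op_algebra\<^esub> ?\<Gamma> (inv\<^bsub>G\<^esub> h))) v p"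
      using v p g h by (simp only: \<Gamma>2 \<Gamma>3 smult \<sigma>_closed)
  qed simp_all
  have \<Gamma>_one: "?\<Gamma> \<one>\<^bsub>G\<^esub> = \<one>\<^bsub>R.op_algebra\<^esub>"
  proof (rule eqI)
    fix v p assume v: "v \<in> carrier fun_space" and p: "p \<in> points"
    have "?W \<one>\<^bsub>G\<^esub> v p = v p"
      using v p point_base[OF p] point_diagonal[OF p, of "\<one>\<^bsub>G\<^esub>"] shift_one[OF p]
      by (simp add: weighted_shift_apply)
    then show "R.act (?\<Gamma> \<one>\<^bsub>G\<^esub>) v p = R.act \<one>\<^bsub>R.op_algebra\<^esub> v p"
      using v by (simp del: function_module_simps)
  qed simp_all
  have "\<sigma> (g, h) = \<zero>\<^bsub>K\<^esub>"
    if g: "g \<in> carrier G" and h: "h \<in> carrier G"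
      and zero_gh: "?\<Gamma> g \<otimes>\<^bsub>R.op_algebra\<^esub> ?\<Gamma> h = \<zero>\<^bsub>R.op_algebra\<^esub>" for g h
  proof (rule ccontr)
    assume \<sigma>_nz: "\<sigma> (g, h) \<noteq> \<zero>\<^bsub>K\<^esub>"
    then obtain p where p: "p \<in> points" and nz: "p (\<one>\<^bsub>G\<^esub>, g) \<noteq> \<zero>\<^bsub>K\<^esub>" "p (g, g \<otimes>\<^bsub>G\<^esub> h) \<noteq> \<zero>\<^bsub>K\<^esub>"
      using point_on g h by blast
    have k: "p (\<one>\<^bsub>G\<^esub>, g \<otimes>\<^bsub>G\<^esub> h) \<noteq> \<zero>\<^bsub>K\<^esub>"
      using point_support[OF p g _ nz(1)] nz(2) g h by simp
    let ?v = "\<lambda>p\<in>points. \<one>\<^bsub>K\<^esub>"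
    have "?W g (?W h ?v) p = \<sigma> (g, h) \<otimes>\<^bsub>K\<^esub> p (\<one>\<^bsub>G\<^esub>, g \<otimes>\<^bsub>G\<^esub> h)"
      using weighted_shift_twice[OF p g h one_function] nz k p g h shift_in_points[OF p _ k]
        point_closed[OF p]
      by (simp add: weighted_shift_apply)
    moreover have "?W g (?W h ?v) p = \<zero>\<^bsub>K\<^esub>"
      using zero[OF one_function p] \<Gamma>2[OF one_function] zero_gh by metis
    ultimately show False
      using K.integral_iff[of "\<sigma> (g, h)" "p (\<one>\<^bsub>G\<^esub>, g \<otimes>\<^bsub>G\<^esub> h)"] \<sigma>_nz k g h point_closed[OF p] by simp
  qed
  then show ?thesis
    unfolding factor_set_def pproj_rep_with_def
    using \<sigma>_fun zero_l zero_r rel_l rel_r \<Gamma>_one by (intro conjI ballI impI) simp_all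
qed

lemma mem_pm: "\<sigma> \<in> pm G K"
  using R.op_algebra_unital_algebra factor_set_of_weighted_shifts
  unfolding pm_def factor_sets_over_def partial_projective_rep_def factor_set_def by blast

section \<open>A partial action with a given twist\<close>

definition cutoff :: "'g \<Rightarrow> (('g \<times> 'g \<Rightarrow> 'k) \<Rightarrow> 'k) \<Rightarrow> ('g \<times> 'g \<Rightarrow> 'k) \<Rightarrow> 'k" where
  "cutoff g v = (\<lambda>p\<in>points. if g \<in> carrier G \<and> p (\<one>\<^bsub>G\<^esub>, g) \<noteq> \<zero>\<^bsub>K\<^esub> then v p else \<zero>\<^bsub>K\<^esub>)"

lemma cutoff_operators: "operator_family K fun_space cutoff"
  by (intro operator_family.intro operator_family_axioms.intro K.field_axioms fun_space_is_module
    fun_space_nontrivial) (auto simp: cutoff_def intro!: restrict_ext)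

interpretation D: operator_family K fun_space cutoff
  by (rule cutoff_operators)

text \<open>
The cutoff operators multiply by indicator functions, so every expression acts as multiplication by a
function on trivializations, its symbol.
\<close>

primrec symbol :: "('g, 'k) alg_expr \<Rightarrow> ('g \<times> 'g \<Rightarrow> 'k) \<Rightarrow> 'k" where
  "symbol (Gen h) p = (if h \<in> carrier G \<and> p (\<one>\<^bsub>G\<^esub>, h) \<noteq> \<zero>\<^bsub>K\<^esub> then \<one>\<^bsub>K\<^esub> else \<zero>\<^bsub>K\<^esub>)"
| "symbol (Scal c) p = (if c \<in> carrier K then c else \<zero>\<^bsub>K\<^esub>)"
| "symbol (Add x y) p = symbol x p \<oplus>\<^bsub>K\<^esub> symbol y p"
| "symbol (Mul x y) p = symbol x p \<otimes>\<^bsub>K\<^esub> symbol y p"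

text \<open>
A lift of \<open>a \<mapsto> \<theta>\<^sub>g (1\<^bsub>g\<inverse>\<^esub> a)\<close> to expressions. The generator \<open>1\<^sub>h\<close> goes to \<open>1\<^sub>g 1\<^bsub>gh\<^esub>\<close>, so the
generated subalgebra is stable although in general it does not contain all functions.
\<close>

primrec translate :: "'g \<Rightarrow> ('g, 'k) alg_expr \<Rightarrow> ('g, 'k) alg_expr" where
  "translate g (Gen h) =
     (if h \<in> carrier G then Mul (Gen g) (Gen (g \<otimes>\<^bsub>G\<^esub> h)) else Scal \<zero>\<^bsub>K\<^esub>)"
| "translate g (Scal c) = Mul (Gen g) (Scal c)"
| "translate g (Add x y) = Add (translate g x) (translate g y)"
| "translate g (Mul x y) = Mul (translate g x) (translate g y)"

lemma symbol_closed [simp]: "symbol x p \<in> carrier K"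
  by (induction x) auto

lemma act_eq_symbol:
  "\<lbrakk>v \<in> carrier fun_space; p \<in> points\<rbrakk> \<Longrightarrow> D.act x v p = symbol x p \<otimes>\<^bsub>K\<^esub> v p"
proof (induction x arbitrary: v)
  case (Mul x y)
  then show ?case
    using D.act_closed[OF Mul.prems(1), of y] by (simp add: K.m_assoc)
qed (auto simp: cutoff_def K.l_distr)

lemma symbol_eq_act: "p \<in> points \<Longrightarrow> symbol x p = D.act x (\<lambda>p\<in>points. \<one>\<^bsub>K\<^esub>) p"
  using act_eq_symbol[OF one_function] by simp

lemma symbol_translate:
  "\<lbrakk>g \<in> carrier G; p \<in> points\<rbrakk> \<Longrightarrow>
    symbol (translate g x) p = (if p (\<one>\<^bsub>G\<^esub>, g) \<noteq> \<zero>\<^bsub>K\<^esub> then symbol x (shift g p) else \<zero>\<^bsub>K\<^esub>)"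
  by (cases "p (\<one>\<^bsub>G\<^esub>, g) = \<zero>\<^bsub>K\<^esub>"; induction x)
    (simp_all add: shift_apply point_support_shift)

lemma symbol_op_algebra [simp]:
  assumes "p \<in> points"
  shows "symbol (D.rep x) p = symbol x p"
    and "symbol (x \<otimes>\<^bsub>D.op_algebra\<^esub> y) p = symbol x p \<otimes>\<^bsub>K\<^esub> symbol y p"
    and "symbol (x \<oplus>\<^bsub>D.op_algebra\<^esub> y) p = symbol x p \<oplus>\<^bsub>K\<^esub> symbol y p"
    and "symbol \<one>\<^bsub>D.op_algebra\<^esub> p = \<one>\<^bsub>K\<^esub>"
    and "symbol \<zero>\<^bsub>D.op_algebra\<^esub> p = \<zero>\<^bsub>K\<^esub>"
    and "c \<in> carrier K \<Longrightarrow> symbol (c \<odot>\<^bsub>D.op_algebra\<^esub> x) p = c \<otimes>\<^bsub>K\<^esub> symbol x p"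
proof -
  show rep: "symbol (D.rep x) p = symbol x p" for x
    using D.act_rep[OF one_function] assms by (simp add: symbol_eq_act)
  show "symbol (x \<otimes>\<^bsub>D.op_algebra\<^esub> y) p = symbol x p \<otimes>\<^bsub>K\<^esub> symbol y p"
    "symbol (x \<oplus>\<^bsub>D.op_algebra\<^esub> y) p = symbol x p \<oplus>\<^bsub>K\<^esub> symbol y p"
    "symbol \<one>\<^bsub>D.op_algebra\<^esub> p = \<one>\<^bsub>K\<^esub>"
    "symbol \<zero>\<^bsub>D.op_algebra\<^esub> p = \<zero>\<^bsub>K\<^esub>"
    "c \<in> carrier K \<Longrightarrow> symbol (c \<odot>\<^bsub>D.op_algebra\<^esub> x) p = c \<otimes>\<^bsub>K\<^esub> symbol x p"
    by (simp_all add: D.op_algebra_def rep)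
qed

lemma op_algebra_eq_symbolI:
  assumes "x \<in> carrier D.op_algebra" "y \<in> carrier D.op_algebra"
    and "\<And>p. p \<in> points \<Longrightarrow> symbol x p = symbol y p"
  shows "x = y"
proof (rule D.op_algebra_eqI[OF assms(1,2)])
  fix v assume v: "v \<in> carrier fun_space"
  show "D.act x v = D.act y v"
    by (rule fun_space_eqI[OF D.act_closed[OF v] D.act_closed[OF v]])
      (simp only: act_eq_symbol[OF v] assms(3))
qed

text \<open>
Identities in this algebra are compared pointwise on symbols. A product \<open>1\<^sub>g 1\<^bsub>gh\<^esub>\<close> vanishes exactly if
no trivialization \<open>p\<close> has both \<open>p (\<one>, g)\<close> and \<open>p (\<one>, g h)\<close> nonzero, which by local triviality is the
case exactly if \<open>\<sigma> (g, h) = 0\<close>.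
\<close>

lemma valued_twist_of_cutoffs:
  defines "e \<equiv> \<lambda>g. D.rep (Gen g)" and "\<theta> \<equiv> \<lambda>g x. D.rep (translate g x)"
  shows "unital_partial_action G K D.op_algebra e \<theta>"
    and "valued_twist G K D.op_algebra e \<theta> \<sigma>"
proof -
  note D_unital = D.op_algebra_unital_algebra
  interpret A: unital_algebra K D.op_algebra by (rule D_unital)
  have e_closed [simp]: "e g \<in> carrier D.op_algebra" for g by (simp add: e_def)
  have \<theta>_closed [simp]: "\<theta> g x \<in> carrier D.op_algebra" for g x by (simp add: \<theta>_def)
  have symbol_e [simp]: "symbol (e g) p = (if p (\<one>\<^bsub>G\<^esub>, g) \<noteq> \<zero>\<^bsub>K\<^esub> then \<one>\<^bsub>K\<^esub> else \<zero>\<^bsub>K\<^esub>)"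
    if "g \<in> carrier G" "p \<in> points" for g p
    using that by (simp add: e_def)
  have symbol_\<theta> [simp]: "symbol (\<theta> g x) p =
      (if p (\<one>\<^bsub>G\<^esub>, g) \<noteq> \<zero>\<^bsub>K\<^esub> then symbol x (shift g p) else \<zero>\<^bsub>K\<^esub>)"
    if "g \<in> carrier G" "p \<in> points" for g x p
    using that by (simp add: \<theta>_def symbol_translate)
  note shift_points [simp] = shift_in_points[simplified]
  show "unital_partial_action G K D.op_algebra e \<theta>"
    by (rule unital_partial_actionI[OF G.group_axioms D_unital])
      (auto intro!: op_algebra_eq_symbolI
        simp: K.m_comm point_base shift_one shift_apply shift_shift point_support_shift)
  let ?\<tau> = "twist_elt G D.op_algebra e \<sigma>"
  have symbol_\<tau>: "symbol (?\<tau> g h) p =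
      (if p (\<one>\<^bsub>G\<^esub>, g) \<noteq> \<zero>\<^bsub>K\<^esub> \<and> p (\<one>\<^bsub>G\<^esub>, g \<otimes>\<^bsub>G\<^esub> h) \<noteq> \<zero>\<^bsub>K\<^esub> then \<sigma> (g, h) else \<zero>\<^bsub>K\<^esub>)"
    if "g \<in> carrier G" "h \<in> carrier G" "p \<in> points" for g h p
    using that by (simp add: twist_elt_def)
  have \<tau>_closed: "?\<tau> g h \<in> carrier D.op_algebra" for g h
    by (simp add: twist_elt_def)
  have zero_iff: "\<sigma> (g, h) = \<zero>\<^bsub>K\<^esub> \<longleftrightarrow> e g \<otimes>\<^bsub>D.op_algebra\<^esub> e (g \<otimes>\<^bsub>G\<^esub> h) = \<zero>\<^bsub>D.op_algebra\<^esub>"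
    if g: "g \<in> carrier G" and h: "h \<in> carrier G" for g h
  proof
    assume "\<sigma> (g, h) = \<zero>\<^bsub>K\<^esub>"
    then have "p (\<one>\<^bsub>G\<^esub>, g) = \<zero>\<^bsub>K\<^esub> \<or> p (\<one>\<^bsub>G\<^esub>, g \<otimes>\<^bsub>G\<^esub> h) = \<zero>\<^bsub>K\<^esub>" if "p \<in> points" for p
      using point_triangle(2)[OF that g h] by blast
    then show "e g \<otimes>\<^bsub>D.op_algebra\<^esub> e (g \<otimes>\<^bsub>G\<^esub> h) = \<zero>\<^bsub>D.op_algebra\<^esub>"
      using g h by (intro op_algebra_eq_symbolI) auto
  next
    assume zero: "e g \<otimes>\<^bsub>D.op_algebra\<^esub> e (g \<otimes>\<^bsub>G\<^esub> h) = \<zero>\<^bsub>D.op_algebra\<^esub>"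
    show "\<sigma> (g, h) = \<zero>\<^bsub>K\<^esub>"
    proof (rule ccontr)
      assume "\<sigma> (g, h) \<noteq> \<zero>\<^bsub>K\<^esub>"
      then obtain p where p: "p \<in> points" "p (\<one>\<^bsub>G\<^esub>, g) \<noteq> \<zero>\<^bsub>K\<^esub>" "p (g, g \<otimes>\<^bsub>G\<^esub> h) \<noteq> \<zero>\<^bsub>K\<^esub>"
        using point_on g h by blast
      have "symbol (e g \<otimes>\<^bsub>D.op_algebra\<^esub> e (g \<otimes>\<^bsub>G\<^esub> h)) p = \<one>\<^bsub>K\<^esub>"
        using p g h point_support_shift[OF p(1) g p(2) h] by simp
      then show False using symbol_op_algebra(5)[OF p(1)] zero by simp
    qed
  qed
  have unit: "?\<tau> \<one>\<^bsub>G\<^esub> g = e g" "?\<tau> g \<one>\<^bsub>G\<^esub> = e g" if g: "g \<in> carrier G" for g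
  proof -
    have "\<sigma> (\<one>\<^bsub>G\<^esub>, g) = \<one>\<^bsub>K\<^esub>" "\<sigma> (g, \<one>\<^bsub>G\<^esub>) = \<one>\<^bsub>K\<^esub>"
      if p: "p \<in> points" and nz: "p (\<one>\<^bsub>G\<^esub>, g) \<noteq> \<zero>\<^bsub>K\<^esub>" for p
    proof -
      have one: "p (\<one>\<^bsub>G\<^esub>, \<one>\<^bsub>G\<^esub>) = \<one>\<^bsub>K\<^esub>" "p (g, g) = \<one>\<^bsub>K\<^esub>"
        using point_diagonal[OF p, of "\<one>\<^bsub>G\<^esub>"] point_diagonal[OF p g] point_base[OF p]
          point_support[OF p g g nz] nz by simp_all
      have "\<sigma> (\<one>\<^bsub>G\<^esub>, g) \<otimes>\<^bsub>K\<^esub> p (\<one>\<^bsub>G\<^esub>, g) = \<one>\<^bsub>K\<^esub> \<otimes>\<^bsub>K\<^esub> p (\<one>\<^bsub>G\<^esub>, g)"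
        using point_triangle(1)[OF p _ g, of "\<one>\<^bsub>G\<^esub>"] nz g one by simp
      then show "\<sigma> (\<one>\<^bsub>G\<^esub>, g) = \<one>\<^bsub>K\<^esub>"
        using K.m_rcancel[OF nz, of "\<sigma> (\<one>\<^bsub>G\<^esub>, g)" "\<one>\<^bsub>K\<^esub>"] point_closed[OF p] g by simp
      have "\<sigma> (g, \<one>\<^bsub>G\<^esub>) \<otimes>\<^bsub>K\<^esub> p (\<one>\<^bsub>G\<^esub>, g) = \<one>\<^bsub>K\<^esub> \<otimes>\<^bsub>K\<^esub> p (\<one>\<^bsub>G\<^esub>, g)"
        using point_triangle(1)[OF p g, of "\<one>\<^bsub>G\<^esub>"] nz g one point_closed[OF p] by simp
      then show "\<sigma> (g, \<one>\<^bsub>G\<^esub>) = \<one>\<^bsub>K\<^esub>"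
        using K.m_rcancel[OF nz, of "\<sigma> (g, \<one>\<^bsub>G\<^esub>)" "\<one>\<^bsub>K\<^esub>"] point_closed[OF p] g by simp
    qed
    then show "?\<tau> \<one>\<^bsub>G\<^esub> g = e g" "?\<tau> g \<one>\<^bsub>G\<^esub> = e g"
      using g by (auto intro!: op_algebra_eq_symbolI simp: \<tau>_closed symbol_\<tau> point_base)
  qed
  have cocycle: "\<theta> g (e (inv\<^bsub>G\<^esub> g) \<otimes>\<^bsub>D.op_algebra\<^esub> ?\<tau> h t) \<otimes>\<^bsub>D.op_algebra\<^esub> ?\<tau> g (h \<otimes>\<^bsub>G\<^esub> t) =
      ?\<tau> g h \<otimes>\<^bsub>D.op_algebra\<^esub> ?\<tau> (g \<otimes>\<^bsub>G\<^esub> h) t"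
    if g: "g \<in> carrier G" and h: "h \<in> carrier G" and t: "t \<in> carrier G" for g h t
  proof (rule op_algebra_eq_symbolI)
    fix p assume p: "p \<in> points"
    let ?gh = "g \<otimes>\<^bsub>G\<^esub> h" and ?ght = "g \<otimes>\<^bsub>G\<^esub> (h \<otimes>\<^bsub>G\<^esub> t)"
    note supp = point_support_shift[OF p g]
    show "symbol (\<theta> g (e (inv\<^bsub>G\<^esub> g) \<otimes>\<^bsub>D.op_algebra\<^esub> ?\<tau> h t) \<otimes>\<^bsub>D.op_algebra\<^esub> ?\<tau> g (h \<otimes>\<^bsub>G\<^esub> t)) p =
        symbol (?\<tau> g h \<otimes>\<^bsub>D.op_algebra\<^esub> ?\<tau> (g \<otimes>\<^bsub>G\<^esub> h) t) p"
    proof (cases "p (\<one>\<^bsub>G\<^esub>, g) \<noteq> \<zero>\<^bsub>K\<^esub> \<and> p (\<one>\<^bsub>G\<^esub>, ?gh) \<noteq> \<zero>\<^bsub>K\<^esub> \<and> p (\<one>\<^bsub>G\<^esub>, ?ght) \<noteq> \<zero>\<^bsub>K\<^esub>")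
      case False
      then show ?thesis
        using p g h t supp by (auto simp: symbol_\<tau> shift_apply G.m_assoc)
    next
      case True
      have "shift g p (\<one>\<^bsub>G\<^esub>, inv\<^bsub>G\<^esub> g) \<noteq> \<zero>\<^bsub>K\<^esub>" "shift g p \<in> points"
        using True p g supp[of "inv\<^bsub>G\<^esub> g"] point_base[OF p] shift_in_points[OF p g]
        by (simp_all add: shift_apply)
      then show ?thesis
        using True p g h t supp point_cocycle[OF p g h t]
        by (simp add: symbol_\<tau> shift_apply G.m_assoc del: mem_Collect_eq)
    qed
  qed simp_all
  show "valued_twist G K D.op_algebra e \<theta> \<sigma>"
    unfolding valued_twist_def
    by (intro conjI ballI) (rule \<sigma>_fun zero_iff unit cocycle; assumption)+
qed

lemma mem_partial_twists: "\<sigma> \<in> partial_twists G K"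
  using D.op_algebra_unital_algebra valued_twist_of_cutoffs
  unfolding partial_twists_def partial_twists_over_def by blast

end

section \<open>Equality of the two sets\<close>

theorem corollary3p8:
  fixes G :: "('g, 'm) monoid_scheme" and K :: "('k, 'n) ring_scheme"
  assumes "group G" and "field K"
  shows "pm G K = partial_twists G K \<and>
    factor_sets_over TYPE('a) G K \<subseteq> pm G K \<and>
    partial_twists_over TYPE('b) G K \<subseteq> partial_twists G K"
proof -
  have pm: "\<sigma> \<in> pm G K" and twists: "\<sigma> \<in> partial_twists G K" if "locally_trivial G K \<sigma>" for \<sigma>
  proof -
    interpret locally_trivial_cocycle G K \<sigma>
      by (intro locally_trivial_cocycle.intro locally_trivial_cocycle_axioms.intro assms that)
    show "\<sigma> \<in> pm G K" by (rule mem_pm)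
    show "\<sigma> \<in> partial_twists G K" by (rule mem_partial_twists)
  qed
  have factor_sets: "pm G K \<subseteq> Collect (locally_trivial G K)"
    "factor_sets_over TYPE('a) G K \<subseteq> Collect (locally_trivial G K)"
    using locally_trivial_if_factor_set[OF assms(1)]
    unfolding pm_def factor_sets_over_def by blast+
  have partial_twists: "partial_twists G K \<subseteq> Collect (locally_trivial G K)"
    "partial_twists_over TYPE('b) G K \<subseteq> Collect (locally_trivial G K)"
    using locally_trivial_if_valued_twist[OF assms(1)]
    unfolding partial_twists_def partial_twists_over_def by blast+
  show ?thesis
    using pm twists factor_sets partial_twists by blast
qed

end
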